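(* Let $0\le p\le n$ and let $\mathcal{N}_{p,n-p}$ be the set of real symmetric orthogonal matrices of order $n$ with the eigenvalues $1$ of multiplicity $p$ and $-1$ of multiplicity $n-p$. Then $\mathcal{N}_{p,n-p}$ is a submanifold of the vector space $S_n$ of real symmetric matrices of order $n$, diffeomorphic to the Grassmannian $Gr(p,n)$ of $p$-dimensional vector subspaces of $\mathbb{R}^n$. In particular $\mathcal{N}_{1,n-1}$ is diffeomorphic to the real projective space $\mathbb{P}^{n-1}(\mathbb{R})$. *)

theory Defs
  imports "HOL-Analysis.Analysis"
begin

section \<open>Smooth maps between subsets of Euclidean spaces\<close>

text \<open>\<^term>\<open>S\<close> is meant to be open here.\<close>

primrec Ck_on ::
  "nat \<Rightarrow> 'a set \<Rightarrow> ('a::euclidean_space \<Rightarrow> 'b::euclidean_space) \<Rightarrow> bool" where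
  "Ck_on 0 S f \<longleftrightarrow> continuous_on S f"
| "Ck_on (Suc k) S f \<longleftrightarrow>
     (\<forall>x\<in>S. f differentiable (at x)) \<and>
     (\<forall>v. Ck_on k S (\<lambda>x. frechet_derivative f (at x) v))"

text \<open>Smoothness on an arbitrary set: locally, the restriction of a smooth map on an open set of
  the ambient space. If \<^term>\<open>S\<close> is relatively open in a linear subspace, this is the ordinary
  notion of a smooth map on an open set of that finite-dimensional vector space.\<close>

definition smooth_on :: "'a set \<Rightarrow> ('a::euclidean_space \<Rightarrow> 'b::euclidean_space) \<Rightarrow> bool" where
  "smooth_on S f \<longleftrightarrow>
     (\<forall>x\<in>S. \<exists>U g. open U \<and> x \<in> U \<and> (\<forall>k. Ck_on k U g) \<and> (\<forall>y\<in>U \<inter> S. g y = f y))"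

section \<open>Smooth manifolds\<close>

text \<open>A chart takes values in a finite-dimensional real vector space, its model space. Since the
  dimension of the manifolds below is not determined by types, the model space is a linear subspace
  of a Euclidean space, and it may vary from chart to chart. The coordinate map is only relevant on
  the domain of the chart.\<close>

datatype ('a, 'e) chart =
  Chart (chart_dom: "'a set") (chart_map: "'a \<Rightarrow> 'e") (chart_model: "'e set")

definition chart_inv :: "('a, 'e) chart \<Rightarrow> 'e \<Rightarrow> 'a" where
  "chart_inv c = inv_into (chart_dom c) (chart_map c)"

text \<open>A manifold is given by an atlas on its underlying set; the topology is the one for which all
  chart domains are open and all charts are homeomorphisms onto their images.\<close>

definition atlas_carrier :: "('a, 'e) chart set \<Rightarrow> 'a set" where
  "atlas_carrier A = (\<Union>c\<in>A. chart_dom c)"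

definition atlas_topology :: "('a, 'e::euclidean_space) chart set \<Rightarrow> 'a topology" where
  "atlas_topology A =
     topology_generated_by {{x \<in> chart_dom c. chart_map c x \<in> T} |c T. c \<in> A \<and> open T}"

definition smooth_atlas :: "nat \<Rightarrow> ('a, 'e::euclidean_space) chart set \<Rightarrow> bool" where
  "smooth_atlas d A \<longleftrightarrow>
     (\<forall>c\<in>A. subspace (chart_model c) \<and> dim (chart_model c) = d \<and>
        inj_on (chart_map c) (chart_dom c) \<and>
        openin (top_of_set (chart_model c)) (chart_map c ` chart_dom c)) \<and>
     (\<forall>c\<in>A. \<forall>c'\<in>A.
        openin (top_of_set (chart_model c)) (chart_map c ` (chart_dom c \<inter> chart_dom c')) \<and>
        smooth_on (chart_map c ` (chart_dom c \<inter> chart_dom c')) (chart_map c' \<circ> chart_inv c))"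

definition smooth_manifold :: "('a, 'e::euclidean_space) chart set \<Rightarrow> bool" where
  "smooth_manifold A \<longleftrightarrow> (\<exists>d. smooth_atlas d A) \<and>
     Hausdorff_space (atlas_topology A) \<and> second_countable (atlas_topology A)"

definition smooth_map ::
  "('a, 'e::euclidean_space) chart set \<Rightarrow> ('b, 'f::euclidean_space) chart set \<Rightarrow> ('a \<Rightarrow> 'b) \<Rightarrow> bool"
  where
  "smooth_map A B f \<longleftrightarrow>
     continuous_map (atlas_topology A) (atlas_topology B) f \<and>
     (\<forall>c\<in>A. \<forall>c'\<in>B.
        smooth_on (chart_map c ` (chart_dom c \<inter> f -` chart_dom c'))
          (chart_map c' \<circ> f \<circ> chart_inv c))"

definition diffeomorphism ::
  "('a, 'e::euclidean_space) chart set \<Rightarrow> ('b, 'f::euclidean_space) chart set \<Rightarrow> ('a \<Rightarrow> 'b) \<Rightarrow> bool"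
  where
  "diffeomorphism A B f \<longleftrightarrow>
     bij_betw f (atlas_carrier A) (atlas_carrier B) \<and>
     smooth_map A B f \<and> smooth_map B A (inv_into (atlas_carrier A) f)"

definition diffeomorphic ::
  "('a, 'e::euclidean_space) chart set \<Rightarrow> ('b, 'f::euclidean_space) chart set \<Rightarrow> bool"
  where
  "diffeomorphic A B \<longleftrightarrow>
     smooth_manifold A \<and> smooth_manifold B \<and> (\<exists>f. diffeomorphism A B f)"

section \<open>Submanifolds of a vector space\<close>

text \<open>The ambient vector space \<^term>\<open>V\<close> is a linear subspace of a Euclidean space. A slice chart is
  a diffeomorphism \<^term>\<open>\<phi>\<close> between open subsets of \<^term>\<open>V\<close> that maps the part of \<^term>\<open>M\<close>
  in its domain onto the part of a linear subspace \<^term>\<open>L\<close> in its image.\<close>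

definition slice_chart ::
  "'e::euclidean_space set \<Rightarrow> nat \<Rightarrow> 'e set \<Rightarrow> 'e set \<Rightarrow> ('e \<Rightarrow> 'e) \<Rightarrow> 'e set \<Rightarrow> bool" where
  "slice_chart V d M U \<phi> L \<longleftrightarrow>
     openin (top_of_set V) U \<and> openin (top_of_set V) (\<phi> ` U) \<and> inj_on \<phi> U \<and>
     smooth_on U \<phi> \<and> smooth_on (\<phi> ` U) (inv_into U \<phi>) \<and>
     subspace L \<and> L \<subseteq> V \<and> dim L = d \<and> \<phi> ` (U \<inter> M) = \<phi> ` U \<inter> L"

definition submanifold :: "'e::euclidean_space set \<Rightarrow> nat \<Rightarrow> 'e set \<Rightarrow> bool" where
  "submanifold V d M \<longleftrightarrow>
     subspace V \<and> M \<subseteq> V \<and> (\<forall>x\<in>M. \<exists>U \<phi> L. x \<in> U \<and> slice_chart V d M U \<phi> L)"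

definition submanifold_atlas ::
  "'e::euclidean_space set \<Rightarrow> nat \<Rightarrow> 'e set \<Rightarrow> ('e, 'e) chart set" where
  "submanifold_atlas V d M = {Chart (U \<inter> M) \<phi> L |U \<phi> L. slice_chart V d M U \<phi> L}"

lemma atlas_carrier_submanifold:
  assumes "submanifold V d M"
  shows "atlas_carrier (submanifold_atlas V d M) = M"
  using assms unfolding atlas_carrier_def submanifold_atlas_def submanifold_def
  by (fastforce intro!: exI)

section \<open>Grassmannians\<close>

definition grassmannian :: "nat \<Rightarrow> (real^'n) set set" where
  "grassmannian p = {V. subspace V \<and> dim V = p}"

text \<open>The space of linear maps from \<^term>\<open>W\<close> to its orthogonal complement, each extended by zero on
  the complement.\<close>

definition hom_complement :: "(real^'n) set \<Rightarrow> (real^'n^'n) set" where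
  "hom_complement W =
     {X. (\<forall>x\<in>W. X *v x \<in> orthogonal_comp W) \<and> (\<forall>x\<in>orthogonal_comp W. X *v x = 0)}"

definition graph_over :: "(real^'n) set \<Rightarrow> real^'n^'n \<Rightarrow> (real^'n) set" where
  "graph_over W X = {x + X *v x |x. x \<in> W}"

text \<open>The standard chart at \<^term>\<open>W\<close>: a subspace of the same dimension meeting the orthogonal
  complement of \<^term>\<open>W\<close> trivially is the graph of a unique linear map from \<^term>\<open>W\<close> to that
  complement.\<close>

definition grassmannian_chart :: "nat \<Rightarrow> (real^'n) set \<Rightarrow> ((real^'n) set, real^'n^'n) chart" where
  "grassmannian_chart p W =
     Chart {V \<in> grassmannian p. V \<inter> orthogonal_comp W = {0}}
       (\<lambda>V. THE X. X \<in> hom_complement W \<and> V = graph_over W X)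
       (hom_complement W)"

definition grassmannian_atlas :: "nat \<Rightarrow> ((real^'n) set, real^'n^'n) chart set" where
  "grassmannian_atlas p = grassmannian_chart p ` grassmannian p"

lemma atlas_carrier_grassmannian:
  "atlas_carrier (grassmannian_atlas p :: ((real^'n) set, real^'n^'n) chart set) = grassmannian p"
proof -
  have "V \<inter> orthogonal_comp V = {0}" if "V \<in> grassmannian p" for V :: "(real^'n) set"
    using that unfolding grassmannian_def orthogonal_comp_def
    by (auto simp: orthogonal_self orthogonal_clauses subspace_0)
  then show ?thesis
    unfolding atlas_carrier_def grassmannian_atlas_def grassmannian_chart_def by auto
qed

section \<open>Real projective space\<close>

definition projective_space :: "(real^'n) set set" where
  "projective_space = {span {x} |x. x \<noteq> 0}"

text \<open>Affine charts: on the lines not contained in the hyperplane where the \<^term>\<open>i\<close>-th coordinate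
  vanishes, the coordinates are the quotients of the homogeneous coordinates by the \<^term>\<open>i\<close>-th
  one. The \<^term>\<open>i\<close>-th quotient, which is always 1, is replaced by 0, so that the values fill the
  linear hyperplane used as the model space.\<close>

definition projective_chart :: "'n \<Rightarrow> ((real^'n) set, real^'n) chart" where
  "projective_chart i =
     Chart {span {x} |x. x $ i \<noteq> 0}
       (\<lambda>l. THE y. \<exists>x\<in>l. x $ i \<noteq> 0 \<and> y = (\<chi> j. if j = i then 0 else x $ j / x $ i))
       {y. y $ i = 0}"

definition projective_atlas :: "((real^'n) set, real^'n) chart set" where
  "projective_atlas = range projective_chart"

lemma atlas_carrier_projective:
  "atlas_carrier (projective_atlas :: ((real^'n) set, real^'n) chart set) = projective_space"
  unfolding atlas_carrier_def projective_atlas_def projective_chart_def projective_space_def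
  by (auto simp: vec_eq_iff)

section \<open>Symmetric orthogonal matrices\<close>

definition symmetric_matrices :: "(real^'n^'n) set" where
  "symmetric_matrices = {A. transpose A = A}"

text \<open>Only used for symmetric matrices, for which geometric and algebraic multiplicity coincide.
  Multiplicity 0 means that the number is not an eigenvalue.\<close>

definition eigenvalue_multiplicity :: "real^'n^'n \<Rightarrow> real \<Rightarrow> nat" where
  "eigenvalue_multiplicity A c = dim {x. A *v x = c *\<^sub>R x}"

definition symmetric_orthogonal_matrices :: "nat \<Rightarrow> nat \<Rightarrow> (real^'n^'n) set" where
  "symmetric_orthogonal_matrices p q =
     {A \<in> symmetric_matrices. orthogonal_matrix A \<and>
        eigenvalue_multiplicity A 1 = p \<and> eigenvalue_multiplicity A (-1) = q}"

end

(*
  A symmetric orthogonal matrix B is the reflection 2 P - 1 in its eigenspace V for the eigenvalue 1,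
  where P is the orthogonal projection onto V; this gives the bijection B |-> V. Two atlases are
  diffeomorphic as soon as both become, through bijections of their carriers with the same subset M
  of a Euclidean space, smooth in both directions with respect to M, so only single charts have to
  be examined.

  Near the projection J onto W, apply to a symmetric matrix P the principal pivot transform with
  respect to the block decomposition given by J, an involution wherever the block J P J is
  invertible. The projection onto the graph of X : W -> W^perp is sent to J + X^T X - X - X^T, so the
  image of M is the graph of a quadratic map in the off-diagonal blocks. Composing with a shear
  flattens this to a linear subspace, which gives slice charts for M, and the off-diagonal block is
  the standard chart of the Grassmannian. The affine charts of projective space are the standard
  charts at the coordinate axes, composed with a linear map.
*)

theory Submission
  imports Defs
begin


section \<open>Calculus of smooth maps\<close>

text \<open>Why the pivot: relative to \<open>W\<close> and its complement, the projection onto the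
  graph of \<open>X\<close> has the blocks \<open>a = (1 + X^T X)^-1\<close>, \<open>a X^T\<close>,
  \<open>X a\<close>, \<open>X a X^T\<close>, all of which involve an inverse. Inverting the block
  \<open>a\<close> clears them: the pivot has the blocks \<open>1 + X^T X\<close>,
  \<open>- X^T\<close>, \<open>- X\<close>, \<open>0\<close>. The vanishing last block, a Schur
  complement up to sign, records that the rank is \<open>dim W\<close>; the first block records
  idempotence. Both directions of a slice chart are compositions of polynomial maps with matrix
  inversion, so their smoothness follows from closure rules.

  Smoothness on a subset means local extension to the ambient space. The set \<open>M\<close> can
  therefore act as a common reference before it is known to be a manifold: every change of
  coordinates is a map defined on a part of \<open>M\<close> after a map into \<open>M\<close>.

  An atlas must have one dimension for all charts, but the model spaces
  \<open>hom_complement W\<close> vary with \<open>W\<close>. The dimension is therefore named by a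
  single \<open>W\<close>, and isometries show that the choice does not matter.\<close>

lemma Ck_on_cong:
  assumes "open S" "\<And>x. x \<in> S \<Longrightarrow> g x = f x" "Ck_on k S f"
  shows "Ck_on k S g"
  using assms(2,3)
proof (induction k arbitrary: f g)
  case 0
  then show ?case by (metis Ck_on.simps(1) continuous_on_cong)
next
  case (Suc k)
  have d: "(g has_derivative frechet_derivative f (at x)) (at x)" if "x \<in> S" for x
  proof (rule has_derivative_transform_within_open[OF _ assms(1) that])
    show "(f has_derivative frechet_derivative f (at x)) (at x)"
      using Suc.prems(2) that by (simp add: frechet_derivative_works)
  qed (rule Suc.prems(1)[symmetric])
  have "frechet_derivative g (at x) v = frechet_derivative f (at x) v" if "x \<in> S" for x v
    using frechet_derivative_at[OF d[OF that]] by simp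
  then have "Ck_on k S (\<lambda>x. frechet_derivative g (at x) v)" for v
    by (rule Suc.IH) (use Suc.prems(2) in simp_all)
  then show ?case
    using d unfolding Ck_on.simps differentiable_def by blast
qed

text \<open>Derivatives at a point are unique, so any explicit formula \<open>f'\<close> can stand
  in for \<open>frechet_derivative\<close>; openness of \<open>S\<close> carries the agreement on to
  higher derivatives.\<close>

lemma Ck_on_SucI:
  assumes "open S" "\<And>x. x \<in> S \<Longrightarrow> (f has_derivative f' x) (at x)"
    and "\<And>v. Ck_on k S (\<lambda>x. f' x v)"
  shows "Ck_on (Suc k) S f"
proof -
  have "frechet_derivative f (at x) v = f' x v" if "x \<in> S" for x v
    using frechet_derivative_at[OF assms(2)[OF that]] by simp
  then have "Ck_on k S (\<lambda>x. frechet_derivative f (at x) v)" for v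
    by (rule Ck_on_cong[OF assms(1) _ assms(3)])
  then show ?thesis
    using assms(2) unfolding Ck_on.simps differentiable_def by blast
qed

lemma Ck_on_Suc_has_derivative:
  assumes "Ck_on (Suc k) S f" "x \<in> S"
  shows "(f has_derivative frechet_derivative f (at x)) (at x)"
  using assms by (simp add: frechet_derivative_works)

lemma Ck_on_subset: "Ck_on k S f \<Longrightarrow> T \<subseteq> S \<Longrightarrow> Ck_on k T f"
proof (induction k arbitrary: f)
  case 0
  then show ?case by (auto intro: continuous_on_subset)
qed auto

lemma Ck_on_Suc_imp: "Ck_on (Suc k) S f \<Longrightarrow> Ck_on k S f"
proof (induction k arbitrary: f)
  case 0
  then show ?case
    by (auto intro!: continuous_at_imp_continuous_on differentiable_imp_continuous_within)
next
  case (Suc k)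
  then show ?case by (metis Ck_on.simps(2))
qed

lemma Ck_on_continuous: "Ck_on k S f \<Longrightarrow> continuous_on S f"
proof (induction k)
  case (Suc k)
  then show ?case by (blast dest: Ck_on_Suc_imp)
qed simp

lemma Ck_on_const: "open S \<Longrightarrow> Ck_on k S (\<lambda>x. c)"
  by (induction k arbitrary: c) (auto intro!: Ck_on_SucI[where f' = "\<lambda>_ _. 0"] simp del: Ck_on.simps(2))

lemma Ck_on_linear:
  assumes "open S" "linear f"
  shows "Ck_on k S f"
proof (cases k)
  case 0
  then show ?thesis using assms by (simp add: linear_continuous_on linear_conv_bounded_linear)
next
  case (Suc m)
  have "Ck_on (Suc m) S f"
    by (rule Ck_on_SucI[where f' = "\<lambda>_. f"])
       (use assms in \<open>auto intro: linear_imp_has_derivative Ck_on_const\<close>)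
  then show ?thesis using Suc by simp
qed

lemma Ck_on_add:
  assumes "open S" "Ck_on k S f" "Ck_on k S g"
  shows "Ck_on k S (\<lambda>x. f x + g x)"
  using assms(2,3)
proof (induction k arbitrary: f g)
  case 0
  then show ?case by (simp add: continuous_on_add)
next
  case (Suc k)
  show ?case
    by (rule Ck_on_SucI[OF assms(1)
          has_derivative_add[OF Ck_on_Suc_has_derivative[OF Suc.prems(1)] Ck_on_Suc_has_derivative[OF Suc.prems(2)]]])
       (use Suc in auto)
qed

text \<open>The product rule leaves a sum of two terms of the same bilinear kind, so the induction
  closes once \<open>f\<close> and \<open>g\<close> are themselves lowered to class
  \<open>k\<close>.\<close>

lemma Ck_on_bilinear:
  assumes "open S" "bounded_bilinear h" "Ck_on k S f" "Ck_on k S g"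
  shows "Ck_on k S (\<lambda>x. h (f x) (g x))"
  using assms(3,4)
proof (induction k arbitrary: f g)
  case 0
  then show ?case by (simp add: bounded_bilinear.continuous_on[OF assms(2)])
next
  case (Suc k)
  show ?case
    by (rule Ck_on_SucI[OF assms(1) bounded_bilinear.FDERIV[OF assms(2)
          Ck_on_Suc_has_derivative[OF Suc.prems(1)] Ck_on_Suc_has_derivative[OF Suc.prems(2)]]])
       (use Suc Ck_on_Suc_imp[OF Suc.prems(1)] Ck_on_Suc_imp[OF Suc.prems(2)] in
         \<open>auto intro!: Ck_on_add[OF assms(1)]\<close>)
qed

lemma Ck_on_sum:
  assumes "open S" "\<And>i. i \<in> I \<Longrightarrow> Ck_on k S (f i)"
  shows "Ck_on k S (\<lambda>x. \<Sum>i\<in>I. f i x)"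
  using assms(2)
  by (induction I rule: infinite_finite_induct) (auto intro!: Ck_on_const Ck_on_add assms(1))

text \<open>In the chain rule the direction fed to the derivative of \<open>g\<close> depends on
  \<open>x\<close>, whereas \<open>Ck_on\<close> speaks of fixed directions. Expanding it in
  \<open>Basis\<close> gives a sum of products to which the induction hypothesis applies.\<close>

lemma Ck_on_compose:
  assumes "open S" "open T" "f ` S \<subseteq> T" "Ck_on k S f" "Ck_on k T g"
  shows "Ck_on k S (\<lambda>x. g (f x))"
  using assms(4,5)
proof (induction k arbitrary: g)
  case 0
  then show ?case using assms(3) by (auto intro: continuous_on_compose2)
next
  case (Suc k)
  have d: "((\<lambda>x. g (f x)) has_derivative
      (\<lambda>v. \<Sum>b\<in>Basis. (frechet_derivative f (at x) v \<bullet> b) *\<^sub>R frechet_derivative g (at (f x)) b)) (at x)"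
    if "x \<in> S" for x
  proof -
    have g: "(g has_derivative frechet_derivative g (at (f x))) (at (f x))"
      by (rule Ck_on_Suc_has_derivative[OF Suc.prems(2)]) (use that assms(3) in auto)
    then have lin: "linear (frechet_derivative g (at (f x)))"
      by (rule has_derivative_linear)
    have "frechet_derivative g (at (f x)) y =
        (\<Sum>b\<in>Basis. (y \<bullet> b) *\<^sub>R frechet_derivative g (at (f x)) b)" for y
    proof -
      have "frechet_derivative g (at (f x)) y =
          frechet_derivative g (at (f x)) (\<Sum>b\<in>Basis. (y \<bullet> b) *\<^sub>R b)"
        by (simp only: euclidean_representation)
      also have "\<dots> = (\<Sum>b\<in>Basis. (y \<bullet> b) *\<^sub>R frechet_derivative g (at (f x)) b)"
        by (simp only: linear_sum[OF lin] linear_scale[OF lin])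
      finally show ?thesis .
    qed
    then have "frechet_derivative g (at (f x)) \<circ> frechet_derivative f (at x) =
        (\<lambda>v. \<Sum>b\<in>Basis. (frechet_derivative f (at x) v \<bullet> b) *\<^sub>R frechet_derivative g (at (f x)) b)"
      unfolding o_def by (intro ext)
    then show ?thesis
      using diff_chain_at[OF Ck_on_Suc_has_derivative[OF Suc.prems(1) that] g]
      unfolding o_def by (simp only:)
  qed
  have "Ck_on k S f" using Suc.prems(1) by (rule Ck_on_Suc_imp)
  then have "Ck_on k S (\<lambda>x. frechet_derivative g (at (f x)) b)" for b
    using Suc.prems(2) by (auto intro: Suc.IH)
  moreover have "Ck_on k S (\<lambda>x. frechet_derivative f (at x) v \<bullet> b)" for v b
    by (rule Ck_on_bilinear[OF assms(1) bounded_bilinear_inner])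
       (use Suc.prems(1) in \<open>auto intro: Ck_on_const assms(1)\<close>)
  ultimately show ?case
    by (intro Ck_on_SucI[OF assms(1) d] Ck_on_sum assms(1)
          Ck_on_bilinear[OF assms(1) bounded_bilinear_scaleR])
qed

text \<open>The derivative \<open>- (inverse x * h * inverse x)\<close> is built from
  \<open>inverse\<close> itself, so class \<open>k\<close> yields class
  \<open>Suc k\<close>.\<close>

lemma Ck_on_inverse: "Ck_on k (- {0}) (inverse :: real \<Rightarrow> real)"
proof (induction k)
  case 0
  then show ?case by (auto intro!: continuous_intros)
next
  case (Suc k)
  have o: "open (- {0::real})" by auto
  have "Ck_on k (- {0::real}) (\<lambda>x. inverse x * v * inverse x)" for v
    by (intro Ck_on_bilinear[OF o bounded_bilinear_mult] Suc Ck_on_const o)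
  then have "Ck_on k (- {0::real}) (\<lambda>x. - (inverse x * v * inverse x))" for v
    by (rule Ck_on_compose[OF o open_UNIV subset_UNIV _ Ck_on_linear[OF open_UNIV linear_uminus]])
  then show ?case
    using has_derivative_inverse'
    by (intro Ck_on_SucI[OF o, of inverse "\<lambda>x h. - (inverse x * h * inverse x)"]) simp_all
qed

section \<open>Smooth maps on arbitrary sets\<close>

lemma smooth_on_subset: "smooth_on S f \<Longrightarrow> T \<subseteq> S \<Longrightarrow> smooth_on T f"
  unfolding smooth_on_def by (meson IntD1 IntD2 IntI subsetD)

lemma smooth_on_cong: "smooth_on S f \<Longrightarrow> (\<And>x. x \<in> S \<Longrightarrow> g x = f x) \<Longrightarrow> smooth_on S g"
  unfolding smooth_on_def by (metis IntD2)

lemma smooth_onI: "open S \<Longrightarrow> (\<And>k. Ck_on k S f) \<Longrightarrow> smooth_on S f"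
  unfolding smooth_on_def by blast

lemma smooth_onE:
  assumes "smooth_on S f" "x \<in> S"
  obtains U g where "open U" "x \<in> U" "\<And>k. Ck_on k U g" "\<And>y. y \<in> U \<Longrightarrow> y \<in> S \<Longrightarrow> g y = f y"
  using bspec[OF assms(1)[unfolded smooth_on_def] assms(2)] by (metis IntI)

lemma smooth_on_continuous:
  assumes "smooth_on S f" shows "continuous_on S f"
  unfolding continuous_on_eq_continuous_within
proof
  fix x assume x: "x \<in> S"
  then obtain U g where U: "open U" "x \<in> U" "Ck_on 0 U g" "\<forall>y\<in>U \<inter> S. g y = f y"
    using assms unfolding smooth_on_def by blast
  then have "continuous_on (S \<inter> U) f"
    by (auto intro: continuous_on_eq[of _ g] continuous_on_subset)
  then show "continuous (at x within S) f"
    using U x at_within_nhd[of x U S "S \<inter> U"] by (auto simp: continuous_on_eq_continuous_within)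
qed

lemma smooth_on_const: "smooth_on S (\<lambda>x. c)"
  by (rule smooth_on_subset[of UNIV]) (auto intro: smooth_onI Ck_on_const)

lemma smooth_on_linear: "linear f \<Longrightarrow> smooth_on S f"
  by (rule smooth_on_subset[of UNIV]) (auto intro: smooth_onI Ck_on_linear)

lemma smooth_on_id: "smooth_on S (\<lambda>x. x)"
  by (intro smooth_on_linear linear_ident)

lemma smooth_on_compose:
  assumes "smooth_on S f" "smooth_on T g" "f ` S \<subseteq> T"
  shows "smooth_on S (\<lambda>x. g (f x))"
  unfolding smooth_on_def
proof
  fix x assume x: "x \<in> S"
  obtain U f' where U: "open U" "x \<in> U" "\<And>k. Ck_on k U f'" "\<And>y. y \<in> U \<Longrightarrow> y \<in> S \<Longrightarrow> f' y = f y"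
    using smooth_onE[OF assms(1) x] by blast
  have fx: "f x \<in> T" using x assms(3) by blast
  obtain V g' where V: "open V" "f x \<in> V" "\<And>k. Ck_on k V g'" "\<And>y. y \<in> V \<Longrightarrow> y \<in> T \<Longrightarrow> g' y = g y"
    using smooth_onE[OF assms(2) fx] by blast
  \<comment> \<open>The local extensions compose only where \<open>f'\<close> lands in the domain of
    \<open>g'\<close>; continuity of \<open>f'\<close> makes this set open.\<close>
  have o: "open (U \<inter> f' -` V)"
    using continuous_open_preimage[OF Ck_on_continuous[OF U(3)]] U V by blast
  have "Ck_on k (U \<inter> f' -` V) (\<lambda>x. g' (f' x))" for k
    by (rule Ck_on_compose[OF o V(1)]) (auto intro: Ck_on_subset[OF U(3)] V(3))
  then show "\<exists>U h. open U \<and> x \<in> U \<and> (\<forall>k. Ck_on k U h) \<and> (\<forall>y\<in>U \<inter> S. h y = g (f y))"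
    using o U V x assms(3)
    by (intro exI[of _ "U \<inter> f' -` V"] exI[of _ "\<lambda>x. g' (f' x)"]) (auto simp: image_subset_iff)
qed

lemma smooth_on_bilinear:
  assumes "bounded_bilinear h" "smooth_on S f" "smooth_on S g"
  shows "smooth_on S (\<lambda>x. h (f x) (g x))"
  unfolding smooth_on_def
proof
  fix x assume x: "x \<in> S"
  obtain U f' where U: "open U" "x \<in> U" "\<And>k. Ck_on k U f'" "\<And>y. y \<in> U \<Longrightarrow> y \<in> S \<Longrightarrow> f' y = f y"
    using smooth_onE[OF assms(2) x] by blast
  obtain V g' where V: "open V" "x \<in> V" "\<And>k. Ck_on k V g'" "\<And>y. y \<in> V \<Longrightarrow> y \<in> S \<Longrightarrow> g' y = g y"
    using smooth_onE[OF assms(3) x] by blast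
  have "Ck_on k (U \<inter> V) (\<lambda>x. h (f' x) (g' x))" for k
    using U(1) V(1)
    by (intro Ck_on_bilinear[OF _ assms(1) Ck_on_subset[OF U(3)] Ck_on_subset[OF V(3)]]) auto
  then show "\<exists>U k. open U \<and> x \<in> U \<and> (\<forall>j. Ck_on j U k) \<and> (\<forall>y\<in>U \<inter> S. k y = h (f y) (g y))"
    using U V by (intro exI[of _ "U \<inter> V"] exI[of _ "\<lambda>x. h (f' x) (g' x)"]) auto
qed

lemma smooth_on_add:
  assumes "smooth_on S f" "smooth_on S g"
  shows "smooth_on S (\<lambda>x. f x + g x)"
  unfolding smooth_on_def
proof
  fix x assume x: "x \<in> S"
  obtain U f' where U: "open U" "x \<in> U" "\<And>k. Ck_on k U f'" "\<And>y. y \<in> U \<Longrightarrow> y \<in> S \<Longrightarrow> f' y = f y"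
    using smooth_onE[OF assms(1) x] by blast
  obtain V g' where V: "open V" "x \<in> V" "\<And>k. Ck_on k V g'" "\<And>y. y \<in> V \<Longrightarrow> y \<in> S \<Longrightarrow> g' y = g y"
    using smooth_onE[OF assms(2) x] by blast
  have "Ck_on k (U \<inter> V) (\<lambda>x. f' x + g' x)" for k
    using U(1) V(1) by (intro Ck_on_add[OF _ Ck_on_subset[OF U(3)] Ck_on_subset[OF V(3)]]) auto
  then show "\<exists>U k. open U \<and> x \<in> U \<and> (\<forall>j. Ck_on j U k) \<and> (\<forall>y\<in>U \<inter> S. k y = f y + g y)"
    using U V by (intro exI[of _ "U \<inter> V"] exI[of _ "\<lambda>x. f' x + g' x"]) auto
qed

lemma smooth_on_linear_compose: "linear h \<Longrightarrow> smooth_on S f \<Longrightarrow> smooth_on S (\<lambda>x. h (f x))"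
  by (rule smooth_on_compose[OF _ smooth_on_linear subset_UNIV])

lemma smooth_on_minus: "smooth_on S f \<Longrightarrow> smooth_on S (\<lambda>x. - f x)"
  by (rule smooth_on_linear_compose[OF linear_uminus])

lemma smooth_on_diff: "smooth_on S f \<Longrightarrow> smooth_on S g \<Longrightarrow> smooth_on S (\<lambda>x. f x - g x)"
  using smooth_on_add[OF _ smooth_on_minus] by fastforce

lemma smooth_on_sum:
  "(\<And>i. i \<in> I \<Longrightarrow> smooth_on S (f i)) \<Longrightarrow> smooth_on S (\<lambda>x. \<Sum>i\<in>I. f i x)"
  by (induction I rule: infinite_finite_induct) (auto intro: smooth_on_const smooth_on_add)

lemma smooth_on_prod:
  fixes f :: "'i \<Rightarrow> 'a::euclidean_space \<Rightarrow> real"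
  shows "(\<And>i. i \<in> I \<Longrightarrow> smooth_on S (f i)) \<Longrightarrow> smooth_on S (\<lambda>x. \<Prod>i\<in>I. f i x)"
  by (induction I rule: infinite_finite_induct)
     (auto intro: smooth_on_const smooth_on_bilinear[OF bounded_bilinear_mult])

lemma smooth_on_divide:
  fixes f g :: "'a::euclidean_space \<Rightarrow> real"
  assumes "smooth_on S f" "smooth_on S g" "\<And>x. x \<in> S \<Longrightarrow> g x \<noteq> 0"
  shows "smooth_on S (\<lambda>x. f x / g x)"
proof -
  have "smooth_on S (\<lambda>x. inverse (g x))"
    by (rule smooth_on_compose[OF assms(2) smooth_onI[OF _ Ck_on_inverse]]) (use assms(3) in auto)
  from smooth_on_bilinear[OF bounded_bilinear_mult assms(1) this]
  show ?thesis by (simp add: divide_inverse)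
qed

lemma smooth_on_vec:
  fixes f :: "'i::finite \<Rightarrow> 'a::euclidean_space \<Rightarrow> 'b::euclidean_space"
  assumes "\<And>i. smooth_on S (f i)"
  shows "smooth_on S (\<lambda>x. \<chi> i. f i x)"
proof -
  have "(\<chi> i. f i x) = (\<Sum>i\<in>UNIV. axis i (f i x))" for x
    by (simp add: vec_eq_iff axis_def)
  moreover have "linear (axis i :: 'b \<Rightarrow> 'b^'i)" for i
    by (rule linearI) (auto simp: axis_def vec_eq_iff)
  ultimately show ?thesis
    using assms by (simp add: smooth_on_sum smooth_on_linear_compose[of "axis _"])
qed

lemma smooth_on_vec_nth: "smooth_on S f \<Longrightarrow> smooth_on S (\<lambda>x. f x $ i)"
  by (rule smooth_on_linear_compose[OF bounded_linear.linear[OF bounded_linear_vec_nth]])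

lemma smooth_on_transpose:
  "smooth_on S f \<Longrightarrow> smooth_on S (\<lambda>x. transpose (f x :: real^'n^'m))"
  unfolding transpose_def by (intro smooth_on_vec smooth_on_vec_nth)

lemma smooth_on_matrix_mult:
  fixes f :: "'a::euclidean_space \<Rightarrow> real^'n^'m" and g :: "'a \<Rightarrow> real^'k^'n"
  shows "smooth_on S f \<Longrightarrow> smooth_on S g \<Longrightarrow> smooth_on S (\<lambda>x. f x ** g x)"
  unfolding matrix_matrix_mult_def
  by (intro smooth_on_vec smooth_on_sum smooth_on_bilinear[OF bounded_bilinear_mult] smooth_on_vec_nth)

lemma smooth_on_det:
  "smooth_on S f \<Longrightarrow> smooth_on S (\<lambda>x. det (f x :: real^'n^'n))"
  unfolding det_def
  by (intro smooth_on_sum smooth_on_prod smooth_on_bilinear[OF bounded_bilinear_mult]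
       smooth_on_vec_nth smooth_on_const)

lemma
  fixes A :: "'a::semiring_1^'n^'m"
  assumes "invertible A"
  shows matrix_inv_right: "A ** matrix_inv A = mat 1"
    and matrix_inv_left: "matrix_inv A ** A = mat 1"
  using someI_ex[OF assms[unfolded invertible_def]] unfolding matrix_inv_def by simp_all

text \<open>By Cramer's rule the entries of the inverse are quotients of polynomials in the entries
  of the matrix, with the nonvanishing denominator \<open>det A\<close>.\<close>

lemma smooth_on_matrix_inv:
  fixes f :: "'a::euclidean_space \<Rightarrow> real^'n^'n"
  assumes "smooth_on S f" "\<And>x. x \<in> S \<Longrightarrow> invertible (f x)"
  shows "smooth_on S (\<lambda>x. matrix_inv (f x))"
proof -
  have eq: "matrix_inv A = (\<chi> k j. det (\<chi> i l. if l = k then axis j 1 $ i else A$i$l) / det A)"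
    if "invertible A" for A :: "real^'n^'n"
  proof -
    have d: "det A \<noteq> 0" using that by (simp add: invertible_det_nz)
    have "A *v column j (matrix_inv A) = axis j 1" for j
      using matrix_inv_right[OF that] by (metis matrix_vector_mul_assoc matrix_vector_mul_lid matrix_vector_mult_basis)
    then have "column j (matrix_inv A) = (\<chi> k. det (\<chi> i l. if l = k then axis j 1 $ i else A$i$l) / det A)" for j
      using cramer[OF d] by blast
    then show ?thesis by (simp add: vec_eq_iff column_def)
  qed
  \<comment> \<open>The case distinction in Cramer's matrix does not depend on \<open>x\<close>, so
    each entry is a constant or a coordinate of \<open>f\<close>.\<close>
  have "smooth_on S (\<lambda>x. if c then a else f x $ i $ l)" for c a i l
    using smooth_on_vec_nth[OF smooth_on_vec_nth[OF assms(1)]]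
    by (cases c) (simp_all add: smooth_on_const)
  then have "smooth_on S (\<lambda>x. \<chi> k j. det (\<chi> i l. if l = k then axis j 1 $ i else f x$i$l) / det (f x))"
    using assms
    by (intro smooth_on_vec smooth_on_divide smooth_on_det) (auto simp: invertible_det_nz)
  then show ?thesis
    by (rule smooth_on_cong) (use assms(2) eq in auto)
qed


section \<open>Manifolds parametrised by a subset of a Euclidean space\<close>

text \<open>Here \<open>\<kappa>\<close> and \<open>\<psi>\<close> are the coordinate map and its inverse, read through the
  parametrisation \<^term>\<open>f\<close> as maps from and to the Euclidean space of \<^term>\<open>M\<close>.\<close>

definition compatible_chart ::
  "'m::euclidean_space set \<Rightarrow> nat \<Rightarrow> ('a \<Rightarrow> 'm) \<Rightarrow> ('a, 'e::euclidean_space) chart \<Rightarrow> bool" where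
  "compatible_chart M d f c \<longleftrightarrow>
     subspace (chart_model c) \<and> dim (chart_model c) = d \<and>
     openin (top_of_set (chart_model c)) (chart_map c ` chart_dom c) \<and>
     openin (top_of_set M) (f ` chart_dom c) \<and>
     (\<exists>\<kappa>. smooth_on (f ` chart_dom c) \<kappa> \<and> (\<forall>x\<in>chart_dom c. \<kappa> (f x) = chart_map c x)) \<and>
     (\<exists>\<psi>. smooth_on (chart_map c ` chart_dom c) \<psi> \<and> (\<forall>x\<in>chart_dom c. \<psi> (chart_map c x) = f x))"

definition compatible_atlas ::
  "'m::euclidean_space set \<Rightarrow> nat \<Rightarrow> ('a \<Rightarrow> 'm) \<Rightarrow> ('a, 'e::euclidean_space) chart set \<Rightarrow> bool" where
  "compatible_atlas M d f A \<longleftrightarrow>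
     bij_betw f (atlas_carrier A) M \<and> (\<forall>c\<in>A. compatible_chart M d f c)"

lemma compatible_chart_kappaE:
  assumes "compatible_chart M d f c"
  obtains \<kappa> where "smooth_on (f ` chart_dom c) \<kappa>" "\<And>x. x \<in> chart_dom c \<Longrightarrow> \<kappa> (f x) = chart_map c x"
  using assms unfolding compatible_chart_def by blast

lemma compatible_chart_psiE:
  assumes "compatible_chart M d f c"
  obtains \<psi> where "smooth_on (chart_map c ` chart_dom c) \<psi>"
    "\<And>x. x \<in> chart_dom c \<Longrightarrow> \<psi> (chart_map c x) = f x"
  using assms unfolding compatible_chart_def by blast

lemma chart_dom_subset_carrier: "c \<in> A \<Longrightarrow> chart_dom c \<subseteq> atlas_carrier A"
  unfolding atlas_carrier_def by blast

lemma compatible_atlas_inj_on: "compatible_atlas M d f A \<Longrightarrow> inj_on f (atlas_carrier A)"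
  unfolding compatible_atlas_def bij_betw_def by blast

text \<open>The map \<open>\<psi>\<close> recovers \<open>f x\<close> from the coordinates of
  \<open>x\<close>, and \<open>f\<close> is injective.\<close>

lemma inj_on_chart_map:
  assumes "compatible_atlas M d f A" "c \<in> A"
  shows "inj_on (chart_map c) (chart_dom c)"
proof -
  obtain \<psi> where "\<And>x. x \<in> chart_dom c \<Longrightarrow> \<psi> (chart_map c x) = f x"
    using assms compatible_chart_psiE unfolding compatible_atlas_def by metis
  moreover have "inj_on f (chart_dom c)"
    using compatible_atlas_inj_on[OF assms(1)] chart_dom_subset_carrier[OF assms(2)]
    by (rule inj_on_subset)
  ultimately show ?thesis by (metis inj_on_def)
qed

lemma chart_inv_chart_map:
  assumes "compatible_atlas M d f A" "c \<in> A" "x \<in> chart_dom c"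
  shows "chart_inv c (chart_map c x) = x"
  unfolding chart_inv_def by (rule inv_into_f_f[OF inj_on_chart_map[OF assms(1,2)] assms(3)])

section \<open>The atlas topology as a subspace topology\<close>

lemma topspace_atlas_topology: "topspace (atlas_topology A) = atlas_carrier A"
proof -
  have "\<Union> {{x \<in> chart_dom c. chart_map c x \<in> T} |c T. c \<in> A \<and> open T} = atlas_carrier A"
    unfolding atlas_carrier_def using open_UNIV by blast
  then show ?thesis unfolding atlas_topology_def by simp
qed

text \<open>Openness can be tested chart by chart, where \<open>f\<close> is the continuous map
  \<open>\<psi>\<close> applied to the coordinates.\<close>

lemma continuous_map_compatible_atlas:
  assumes "compatible_atlas M d f A"
  shows "continuous_map (atlas_topology A) (top_of_set M) f"
proof -
  have "openin (atlas_topology A) {x \<in> atlas_carrier A. f x \<in> W}" if W: "open W" for W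
  proof -
    have "openin (atlas_topology A) {x \<in> chart_dom c. f x \<in> W}" if c: "c \<in> A" for c
    proof -
      obtain \<psi> where \<psi>: "smooth_on (chart_map c ` chart_dom c) \<psi>"
        "\<And>x. x \<in> chart_dom c \<Longrightarrow> \<psi> (chart_map c x) = f x"
        using assms c compatible_chart_psiE unfolding compatible_atlas_def by metis
      obtain T where T: "open T" "chart_map c ` chart_dom c \<inter> \<psi> -` W = chart_map c ` chart_dom c \<inter> T"
        using continuous_openin_preimage_gen[OF smooth_on_continuous[OF \<psi>(1)] W]
        by (auto simp: openin_open)
      have "f x \<in> W \<longleftrightarrow> chart_map c x \<in> T" if "x \<in> chart_dom c" for x
        using T(2) that unfolding \<psi>(2)[OF that, symmetric] by blast
      then have "{x \<in> chart_dom c. f x \<in> W} = {x \<in> chart_dom c. chart_map c x \<in> T}"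
        by blast
      then show ?thesis
        unfolding atlas_topology_def using c T(1) by (intro topology_generated_by_Basis) blast
    qed
    then have "openin (atlas_topology A) (\<Union>c\<in>A. {x \<in> chart_dom c. f x \<in> W})"
      by (intro openin_Union) blast
    moreover have "(\<Union>c\<in>A. {x \<in> chart_dom c. f x \<in> W}) = {x \<in> atlas_carrier A. f x \<in> W}"
      unfolding atlas_carrier_def by blast
    ultimately show ?thesis by simp
  qed
  moreover have "f ` atlas_carrier A \<subseteq> M"
    using assms unfolding compatible_atlas_def bij_betw_def by blast
  ultimately show ?thesis
    unfolding continuous_map_in_subtopology
    by (auto simp: continuous_map topspace_atlas_topology)
qed

text \<open>Only generating sets of the atlas topology have to be tested. The map \<open>f\<close>
  carries such a set to a preimage under \<open>\<kappa>\<close>, open in the image of a chart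
  domain, which is in turn open in \<open>M\<close>.\<close>

lemma continuous_map_compatible_atlas_inv:
  assumes "compatible_atlas M d f A"
  shows "continuous_map (top_of_set M) (atlas_topology A) (inv_into (atlas_carrier A) f)"
proof -
  let ?g = "inv_into (atlas_carrier A) f"
  have M: "f ` atlas_carrier A = M"
    using assms unfolding compatible_atlas_def bij_betw_def by blast
  have gf: "?g (f x) = x" if "x \<in> atlas_carrier A" for x
    using inv_into_f_f[OF compatible_atlas_inj_on[OF assms] that] .
  have "openin (top_of_set M) (?g -` {x \<in> chart_dom c. chart_map c x \<in> T} \<inter> M)"
    if c: "c \<in> A" and T: "open T" for c T
  proof -
    obtain \<kappa> where \<kappa>: "smooth_on (f ` chart_dom c) \<kappa>"
      "\<And>x. x \<in> chart_dom c \<Longrightarrow> \<kappa> (f x) = chart_map c x"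
      using assms c compatible_chart_kappaE unfolding compatible_atlas_def by metis
    have "?g -` {x \<in> chart_dom c. chart_map c x \<in> T} \<inter> M = f ` chart_dom c \<inter> \<kappa> -` T"
      using \<kappa>(2) chart_dom_subset_carrier[OF c] gf unfolding M[symmetric] by (auto 0 3)
    moreover have "openin (top_of_set (f ` chart_dom c)) (f ` chart_dom c \<inter> \<kappa> -` T)"
      by (rule continuous_openin_preimage_gen[OF smooth_on_continuous[OF \<kappa>(1)] T])
    moreover have "openin (top_of_set M) (f ` chart_dom c)"
      using assms c unfolding compatible_atlas_def compatible_chart_def by blast
    ultimately show ?thesis by (metis openin_trans)
  qed
  moreover have "?g ` M \<subseteq> topspace (atlas_topology A)"
    unfolding M[symmetric] using gf by (auto simp: topspace_atlas_topology)
  ultimately show ?thesis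
    unfolding atlas_topology_def by (intro continuous_on_generated_topo) (auto simp del: UN_simps)
qed

text \<open>Transports from \<open>M\<close> the Hausdorff property and second countability, the
  conditions in \<open>smooth_manifold\<close> that are global rather than about charts.\<close>

lemma atlas_topology_homeomorphic:
  assumes "compatible_atlas M d f A"
  shows "atlas_topology A homeomorphic_space top_of_set M"
proof -
  have "bij_betw f (atlas_carrier A) M"
    using assms unfolding compatible_atlas_def by blast
  then have "homeomorphic_maps (atlas_topology A) (top_of_set M) f (inv_into (atlas_carrier A) f)"
    unfolding homeomorphic_maps_def
    using continuous_map_compatible_atlas[OF assms] continuous_map_compatible_atlas_inv[OF assms]
    by (auto simp: topspace_atlas_topology bij_betw_inv_into_left bij_betw_inv_into_right)
  then show ?thesis unfolding homeomorphic_space_def by blast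
qed

lemma second_countable_euclidean:
  "second_countable (euclidean :: 'a::second_countable_topology topology)"
proof -
  obtain B :: "'a set set" where "countable B" "topological_basis B"
    using ex_countable_basis by blast
  moreover have "open b" if "b \<in> B" for b
    using topological_basis_open \<open>topological_basis B\<close> that .
  moreover have "\<exists>b\<in>B. x \<in> b \<and> b \<subseteq> U" if "open U" "x \<in> U" for U x
    using topological_basisE[OF \<open>topological_basis B\<close> that] by metis
  ultimately show ?thesis
    unfolding second_countable_def open_openin[symmetric] by blast
qed

lemma smooth_manifold_compatible_atlas:
  assumes "compatible_atlas M d f A"
  shows "smooth_manifold A"
proof -
  have cc: "compatible_chart M d f c" if "c \<in> A" for c
    using assms that unfolding compatible_atlas_def by blast
  have trans: "openin (top_of_set (chart_model c)) (chart_map c ` (chart_dom c \<inter> chart_dom c')) \<and>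
        smooth_on (chart_map c ` (chart_dom c \<inter> chart_dom c')) (chart_map c' \<circ> chart_inv c)"
    if c: "c \<in> A" "c' \<in> A" for c c'
  proof -
    obtain \<psi> where \<psi>: "smooth_on (chart_map c ` chart_dom c) \<psi>"
      "\<And>x. x \<in> chart_dom c \<Longrightarrow> \<psi> (chart_map c x) = f x"
      using cc[OF c(1)] compatible_chart_psiE by metis
    obtain \<kappa> where \<kappa>: "smooth_on (f ` chart_dom c') \<kappa>"
      "\<And>x. x \<in> chart_dom c' \<Longrightarrow> \<kappa> (f x) = chart_map c' x"
      using cc[OF c(2)] compatible_chart_kappaE by metis
    have fM: "f ` chart_dom c \<subseteq> M"
      using cc[OF c(1)] unfolding compatible_chart_def openin_subtopology by auto
    obtain W where W: "open W" "f ` chart_dom c' = M \<inter> W"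
      using cc[OF c(2)] unfolding compatible_chart_def openin_open by blast
    \<comment> \<open>Injectivity of \<open>f\<close> lets points be replaced by their images in
      \<open>M\<close>, so the overlap becomes the preimage under \<open>\<psi>\<close> of an
      ambient open set.\<close>
    have mem: "x \<in> chart_dom c'" if "x \<in> chart_dom c" "f x \<in> f ` chart_dom c'" for x
      using that inj_onD[OF compatible_atlas_inj_on[OF assms]] chart_dom_subset_carrier c by blast
    have "chart_map c ` (chart_dom c \<inter> chart_dom c') = chart_map c ` chart_dom c \<inter> \<psi> -` W"
    proof -
      have "x \<in> chart_dom c' \<longleftrightarrow> \<psi> (chart_map c x) \<in> W" if "x \<in> chart_dom c" for x
        using that mem[OF that] W(2) fM \<psi>(2) by auto
      then show ?thesis by blast
    qed
    moreover have "openin (top_of_set (chart_map c ` chart_dom c)) (chart_map c ` chart_dom c \<inter> \<psi> -` W)"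
      by (rule continuous_openin_preimage_gen[OF smooth_on_continuous[OF \<psi>(1)] W(1)])
    moreover have "openin (top_of_set (chart_model c)) (chart_map c ` chart_dom c)"
      using cc[OF c(1)] unfolding compatible_chart_def by blast
    ultimately have "openin (top_of_set (chart_model c)) (chart_map c ` (chart_dom c \<inter> chart_dom c'))"
      by (metis openin_trans)
    moreover have "smooth_on (chart_map c ` (chart_dom c \<inter> chart_dom c')) (\<lambda>y. \<kappa> (\<psi> y))"
      by (rule smooth_on_compose[OF smooth_on_subset[OF \<psi>(1)] \<kappa>(1)]) (auto simp: \<psi>(2))
    then have "smooth_on (chart_map c ` (chart_dom c \<inter> chart_dom c')) (chart_map c' \<circ> chart_inv c)"
      by (rule smooth_on_cong) (auto simp: chart_inv_chart_map[OF assms c(1)] \<psi>(2) \<kappa>(2))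
    ultimately show ?thesis by blast
  qed
  have "smooth_atlas d A"
    unfolding smooth_atlas_def
    using cc trans inj_on_chart_map[OF assms] by (simp add: compatible_chart_def)
  moreover have "Hausdorff_space (top_of_set M)"
    by (simp add: Hausdorff_space_subtopology Hausdorff_space_euclidean)
  moreover have "second_countable (top_of_set M)"
    by (intro second_countable_subtopology second_countable_euclidean)
  ultimately show ?thesis
    using homeomorphic_Hausdorff_space[OF atlas_topology_homeomorphic[OF assms]]
      homeomorphic_space_second_countability[OF atlas_topology_homeomorphic[OF assms]]
    unfolding smooth_manifold_def by blast
qed

text \<open>The equation \<open>g (h x) = f x\<close> says that \<open>h\<close> becomes the
  identity of \<open>M\<close> when both sides are read through their parametrisations; its local
  expression is therefore \<open>\<kappa>\<close> after \<open>\<psi>\<close>.\<close>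

lemma smooth_map_compatible_atlas:
  assumes A: "compatible_atlas M d f A" and B: "compatible_atlas M d' g B"
    and h: "\<And>x. x \<in> atlas_carrier A \<Longrightarrow> h x \<in> atlas_carrier B \<and> g (h x) = f x"
  shows "smooth_map A B h"
  unfolding smooth_map_def
proof (intro conjI ballI)
  have "continuous_map (atlas_topology A) (atlas_topology B) (inv_into (atlas_carrier B) g \<circ> f)"
    by (rule continuous_map_compose[OF continuous_map_compatible_atlas[OF A]
          continuous_map_compatible_atlas_inv[OF B]])
  then show "continuous_map (atlas_topology A) (atlas_topology B) h"
  proof (rule continuous_map_eq)
    fix x assume "x \<in> topspace (atlas_topology A)"
    then show "(inv_into (atlas_carrier B) g \<circ> f) x = h x"
      using h[of x] inv_into_f_f[OF compatible_atlas_inj_on[OF B], of "h x"]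
      by (simp add: topspace_atlas_topology)
  qed
next
  fix c c' assume c: "c \<in> A" "c' \<in> B"
  obtain \<psi> where \<psi>: "smooth_on (chart_map c ` chart_dom c) \<psi>"
    "\<And>x. x \<in> chart_dom c \<Longrightarrow> \<psi> (chart_map c x) = f x"
    using A c(1) compatible_chart_psiE unfolding compatible_atlas_def by metis
  obtain \<kappa> where \<kappa>: "smooth_on (g ` chart_dom c') \<kappa>"
    "\<And>x. x \<in> chart_dom c' \<Longrightarrow> \<kappa> (g x) = chart_map c' x"
    using B c(2) compatible_chart_kappaE unfolding compatible_atlas_def by metis
  have gh: "g (h x) = f x" if "x \<in> chart_dom c" for x
    using h that chart_dom_subset_carrier[OF c(1)] by blast
  have "smooth_on (chart_map c ` (chart_dom c \<inter> h -` chart_dom c')) (\<lambda>y. \<kappa> (\<psi> y))"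
    by (rule smooth_on_compose[OF smooth_on_subset[OF \<psi>(1)] \<kappa>(1)]) (auto simp: \<psi>(2) gh[symmetric])
  then show "smooth_on (chart_map c ` (chart_dom c \<inter> h -` chart_dom c'))
      (chart_map c' \<circ> h \<circ> chart_inv c)"
    by (rule smooth_on_cong)
       (auto simp: chart_inv_chart_map[OF A c(1)] \<psi>(2) \<kappa>(2) gh[symmetric])
qed

lemma diffeomorphic_compatible_atlas:
  assumes A: "compatible_atlas M d f A" and B: "compatible_atlas M d' g B"
  shows "diffeomorphic A B"
proof -
  define h where "h = inv_into (atlas_carrier B) g \<circ> f"
  have f: "bij_betw f (atlas_carrier A) M" and g: "bij_betw g (atlas_carrier B) M"
    using A B unfolding compatible_atlas_def by auto
  have bij: "bij_betw h (atlas_carrier A) (atlas_carrier B)"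
    unfolding h_def by (rule bij_betw_trans[OF f bij_betw_inv_into[OF g]])
  have h: "h x \<in> atlas_carrier B \<and> g (h x) = f x" if "x \<in> atlas_carrier A" for x
    using bij_betwE[OF bij] bij_betwE[OF f] that bij_betw_inv_into_right[OF g] by (auto simp: h_def)
  have "inv_into (atlas_carrier A) h y \<in> atlas_carrier A \<and> f (inv_into (atlas_carrier A) h y) = g y"
    if "y \<in> atlas_carrier B" for y
    using bij_betwE[OF bij_betw_inv_into[OF bij]] that h bij_betw_inv_into_right[OF bij that]
    by metis
  then have "diffeomorphism A B h"
    unfolding diffeomorphism_def
    using bij h smooth_map_compatible_atlas[OF A B] smooth_map_compatible_atlas[OF B A] by blast
  then show ?thesis
    unfolding diffeomorphic_def
    using smooth_manifold_compatible_atlas[OF A] smooth_manifold_compatible_atlas[OF B] by blast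
qed

section \<open>Submanifolds and slice charts\<close>

lemma compatible_submanifold_atlas:
  assumes "submanifold V d M"
  shows "compatible_atlas M d id (submanifold_atlas V d M)"
  unfolding compatible_atlas_def
proof (intro conjI ballI)
  show "bij_betw id (atlas_carrier (submanifold_atlas V d M)) M"
    by (simp add: atlas_carrier_submanifold[OF assms])
next
  fix c assume "c \<in> submanifold_atlas V d M"
  then obtain U \<phi> L where c: "c = Chart (U \<inter> M) \<phi> L" and s: "slice_chart V d M U \<phi> L"
    unfolding submanifold_atlas_def by blast
  have img: "\<phi> ` (U \<inter> M) = \<phi> ` U \<inter> L" and "L \<subseteq> V" "M \<subseteq> V"
    using s assms unfolding slice_chart_def submanifold_def by auto
  obtain S T where ST: "open S" "\<phi> ` U = V \<inter> S" "open T" "U = V \<inter> T"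
    using s unfolding slice_chart_def openin_open by blast
  \<comment> \<open>Since \<open>L\<close> and \<open>M\<close> lie in \<open>V\<close>, the ambient
    open sets that cut the image and \<open>U\<close> out of \<open>V\<close> also cut out their
    parts in \<open>L\<close> and \<open>M\<close>.\<close>
  have "\<phi> ` (U \<inter> M) = L \<inter> S" "U \<inter> M = M \<inter> T"
    using img ST(2,4) \<open>L \<subseteq> V\<close> \<open>M \<subseteq> V\<close> by blast+
  then have "openin (top_of_set L) (\<phi> ` (U \<inter> M))" "openin (top_of_set M) (U \<inter> M)"
    using ST(1,3) by (auto simp: openin_open)
  moreover have "smooth_on (U \<inter> M) \<phi>" "smooth_on (\<phi> ` (U \<inter> M)) (inv_into U \<phi>)"
    using s smooth_on_subset[of U \<phi> "U \<inter> M"] smooth_on_subset[of "\<phi> ` U" "inv_into U \<phi>" "\<phi> ` (U \<inter> M)"]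
    unfolding slice_chart_def by blast+
  moreover have "inv_into U \<phi> (\<phi> x) = x" if "x \<in> U \<inter> M" for x
    using s that unfolding slice_chart_def by simp
  ultimately show "compatible_chart M d id c"
    using s unfolding compatible_chart_def c slice_chart_def image_id id_apply chart.sel by blast
qed

text \<open>A two-sided inverse \<open>\<psi>\<close> given by a formula agrees with
  \<open>inv_into U \<phi>\<close> on the image, which is then \<open>U'\<close>; this makes the
  smoothness of the inverse accessible.\<close>

lemma slice_chartI:
  assumes "openin (top_of_set V) U" "openin (top_of_set V) U'"
    and "\<phi> ` U \<subseteq> U'" "\<psi> ` U' \<subseteq> U" "\<And>x. x \<in> U \<Longrightarrow> \<psi> (\<phi> x) = x" "\<And>y. y \<in> U' \<Longrightarrow> \<phi> (\<psi> y) = y"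
    and "smooth_on U \<phi>" "smooth_on U' \<psi>"
    and "subspace L" "L \<subseteq> V" "dim L = d"
    and "\<And>x. x \<in> U \<Longrightarrow> x \<in> M \<longleftrightarrow> \<phi> x \<in> L"
  shows "slice_chart V d M U \<phi> L"
proof -
  have inj: "inj_on \<phi> U" using assms(5) by (metis inj_onI)
  have img: "\<phi> ` U = U'" using assms(3,4,6) by force
  have "smooth_on (\<phi> ` U) (inv_into U \<phi>)"
    unfolding img
    by (rule smooth_on_cong[OF assms(8)])
       (use assms(4,6) inj in \<open>auto intro!: inv_into_f_eq\<close>)
  moreover have "\<phi> ` (U \<inter> M) = \<phi> ` U \<inter> L" using assms(12) by blast
  ultimately show ?thesis
    unfolding slice_chart_def using assms inj img by auto
qed


section \<open>Matrix algebra\<close>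

lemma matrix_add_rdistrib: "((A :: 'a::semiring_1^'n^'m) + B) ** C = A ** C + B ** C"
  by (simp add: vec_eq_iff matrix_matrix_mult_def sum.distrib distrib_right)

lemma matrix_diff_ldistrib: "(A :: 'a::ring_1^'n^'m) ** (B - C) = A ** B - A ** C"
  by (simp add: vec_eq_iff matrix_matrix_mult_def sum_subtractf right_diff_distrib)

lemma matrix_diff_rdistrib: "((A :: 'a::ring_1^'n^'m) - B) ** C = A ** C - B ** C"
  by (simp add: vec_eq_iff matrix_matrix_mult_def sum_subtractf left_diff_distrib)

lemma matrix_minus_left: "(- (A :: 'a::ring_1^'n^'m)) ** B = - (A ** B)"
  by (simp add: vec_eq_iff matrix_matrix_mult_def sum_negf)

lemma matrix_minus_right: "(A :: 'a::ring_1^'n^'m) ** (- B) = - (A ** B)"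
  by (simp add: vec_eq_iff matrix_matrix_mult_def sum_negf)

lemma matrix_zero_left: "(0 :: 'a::semiring_1^'n^'m) ** A = 0"
  by (simp add: vec_eq_iff matrix_matrix_mult_def)

lemma matrix_zero_right: "(A :: 'a::semiring_1^'n^'m) ** 0 = 0"
  by (simp add: vec_eq_iff matrix_matrix_mult_def)

lemma transpose_add: "transpose (A + B) = transpose A + transpose B"
  by (simp add: vec_eq_iff transpose_def)

lemma transpose_diff: "transpose (A - B) = transpose A - transpose B"
  by (simp add: vec_eq_iff transpose_def)

lemma transpose_minus: "transpose (- A) = - transpose A"
  by (simp add: vec_eq_iff transpose_def)

lemma transpose_zero: "transpose 0 = 0"
  by (simp add: vec_eq_iff transpose_def)

lemmas matrix_ring_simps =
  matrix_add_ldistrib matrix_add_rdistrib matrix_diff_ldistrib matrix_diff_rdistrib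
  matrix_minus_left matrix_minus_right matrix_zero_left matrix_zero_right
  matrix_mul_assoc[symmetric] transpose_add transpose_diff transpose_minus transpose_zero
  matrix_transpose_mul

text \<open>Products are normalised to the right, so a relation such as \<open>J ** J = J\<close>
  must also apply at the head of a longer product.\<close>

lemma matrix_mul_cong_right: "A ** B = C \<Longrightarrow> A ** (B ** D) = C ** D"
  by (simp add: matrix_mul_assoc)

section \<open>Principal pivot transform\<close>

text \<open>For an idempotent \<open>J\<close> and blocks \<open>a, b, c, d\<close> of
  \<open>P\<close>, this is the block triangular matrix with rows \<open>a, b\<close> and
  \<open>0, 1\<close>. It expresses invertibility of the block \<open>a\<close> by a matrix of full
  size.\<close>

definition pivot_den :: "real^'n^'n \<Rightarrow> real^'n^'n \<Rightarrow> real^'n^'n" where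
  "pivot_den J P = mat 1 - J + J ** P"

text \<open>In the block decomposition given by an idempotent \<^term>\<open>J\<close>, and with blocks \<open>a, b, c, d\<close>
  of \<^term>\<open>P\<close>, this has the blocks \<open>a\<^sup>-\<^sup>1, - a\<^sup>-\<^sup>1 b, - c a\<^sup>-\<^sup>1, c a\<^sup>-\<^sup>1 b - d\<close>. The signs make it
  symmetric for symmetric \<^term>\<open>P\<close>.\<close>

definition pivot :: "real^'n^'n \<Rightarrow> real^'n^'n \<Rightarrow> real^'n^'n" where
  "pivot J P = (J - (mat 1 - J) ** P) ** matrix_inv (pivot_den J P)"

text \<open>The upper block row of the pivot is \<open>a^-1, - a^-1 b\<close>, so its denominator is
  the inverse of \<open>pivot_den J P\<close>.\<close>

lemma pivot_den_pivot:
  assumes "J ** J = J" "invertible (pivot_den J P)"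
  shows "pivot_den J (pivot J P) ** pivot_den J P = mat 1"
proof -
  have 1: "matrix_inv (pivot_den J P) ** pivot_den J P = mat 1"
    by (rule matrix_inv_left[OF assms(2)])
  \<comment> \<open>Multiplying by the denominator clears the inverse; a polynomial identity in
    \<open>J\<close> and \<open>P\<close> remains.\<close>
  have "pivot_den J (pivot J P) ** pivot_den J P =
      (mat 1 - J) ** pivot_den J P + J ** (J - (mat 1 - J) ** P)"
    unfolding pivot_def pivot_den_def[of J "_ ** _"]
    by (simp add: matrix_ring_simps 1)
  also have "\<dots> = mat 1"
    unfolding pivot_den_def
    by (simp add: matrix_ring_simps assms(1) matrix_mul_cong_right[OF assms(1)])
  finally show ?thesis .
qed

lemma invertible_pivot_den_pivot:
  assumes "J ** J = J" "invertible (pivot_den J P)"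
  shows "invertible (pivot_den J (pivot J P))"
  using pivot_den_pivot[OF assms] invertible_right_inverse by blast

lemma pivot_pivot:
  assumes "J ** J = J" "invertible (pivot_den J P)"
  shows "pivot J (pivot J P) = P"
proof -
  let ?H = "pivot_den J P"
  have 1: "pivot J P ** ?H = J - (mat 1 - J) ** P"
    unfolding pivot_def by (simp add: matrix_mul_assoc[symmetric] matrix_inv_left[OF assms(2)])
  \<comment> \<open>The two denominators are mutually inverse, so the second pivot can be written
    with \<open>?H\<close> in place of an inverse.\<close>
  have "matrix_inv (pivot_den J (pivot J P)) =
      matrix_inv (pivot_den J (pivot J P)) ** (pivot_den J (pivot J P) ** ?H)"
    by (simp add: pivot_den_pivot[OF assms])
  also have "\<dots> = ?H"
    by (simp add: matrix_mul_assoc matrix_inv_left[OF invertible_pivot_den_pivot[OF assms]])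
  finally have "pivot J (pivot J P) = (J - (mat 1 - J) ** pivot J P) ** ?H"
    by (simp add: pivot_def[of J "pivot J P"])
  also have "\<dots> = J ** ?H - (mat 1 - J) ** (J - (mat 1 - J) ** P)"
    by (simp add: matrix_diff_rdistrib[of J "_ ** pivot J P"] matrix_mul_assoc[symmetric] 1)
  also have "\<dots> = P"
    unfolding pivot_den_def
    by (simp add: matrix_ring_simps assms(1) matrix_mul_cong_right[OF assms(1)])
  finally show ?thesis .
qed

text \<open>A quotient \<open>G H^-1\<close> is symmetric when \<open>H^T G = G^T H\<close>, which
  for symmetric \<open>P\<close> is a polynomial identity.\<close>

lemma transpose_pivot:
  assumes "transpose J = J" "J ** J = J" "transpose P = P" "invertible (pivot_den J P)"
  shows "transpose (pivot J P) = pivot J P"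
proof -
  let ?H = "pivot_den J P" and ?G = "J - (mat 1 - J) ** P"
  have 1: "?H ** matrix_inv ?H = mat 1"
    by (rule matrix_inv_right[OF assms(4)])
  have eq: "transpose ?H ** ?G = transpose ?G ** ?H"
    unfolding pivot_den_def
    by (simp add: matrix_ring_simps assms matrix_mul_cong_right[OF assms(2)])
  have "transpose (pivot J P) = transpose (matrix_inv ?H) ** (transpose ?G ** ?H) ** matrix_inv ?H"
    by (simp add: pivot_def matrix_transpose_mul matrix_mul_assoc[symmetric] 1)
  also have "\<dots> = transpose (?H ** matrix_inv ?H) ** ?G ** matrix_inv ?H"
    by (simp add: eq[symmetric] matrix_transpose_mul matrix_mul_assoc)
  also have "\<dots> = pivot J P"
    unfolding 1 pivot_def by simp
  finally show ?thesis .
qed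

lemma smooth_on_pivot_den: "smooth_on S f \<Longrightarrow> smooth_on S (\<lambda>x. pivot_den J (f x))"
  unfolding pivot_den_def by (intro smooth_on_add smooth_on_const smooth_on_matrix_mult)

lemma smooth_on_pivot:
  assumes "smooth_on S f" "\<And>x. x \<in> S \<Longrightarrow> invertible (pivot_den J (f x))"
  shows "smooth_on S (\<lambda>x. pivot J (f x))"
  unfolding pivot_def
  by (intro smooth_on_matrix_mult smooth_on_matrix_inv smooth_on_pivot_den smooth_on_diff
        smooth_on_const assms)

lemma open_invertible_pivot_den:
  assumes "smooth_on UNIV f"
  shows "open {x. invertible (pivot_den J (f x))}"
proof -
  have "continuous_on UNIV (\<lambda>x. det (pivot_den J (f x)))"
    by (intro smooth_on_continuous smooth_on_det smooth_on_pivot_den assms)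
  then have "open ((\<lambda>x. det (pivot_den J (f x))) -` (- {0}))"
    by (intro open_vimage) auto
  then show ?thesis by (simp add: invertible_det_nz vimage_def)
qed

section \<open>Straightening the quadratic term\<close>

definition shear :: "real^'n^'n \<Rightarrow> real^'n^'n \<Rightarrow> real^'n^'n" where
  "shear J S = S - J - J ** S ** (mat 1 - J) ** S ** J"

definition unshear :: "real^'n^'n \<Rightarrow> real^'n^'n \<Rightarrow> real^'n^'n" where
  "unshear J S = S + J + J ** S ** (mat 1 - J) ** S ** J"

text \<open>The quadratic correction is formed from the off-diagonal blocks and lands in the upper
  left block, so shearing leaves it unchanged and the same term can be added back.\<close>

lemma unshear_shear: "J ** J = J \<Longrightarrow> unshear J (shear J S) = S"
  unfolding shear_def unshear_def
  by (simp add: matrix_ring_simps matrix_mul_cong_right[of J J J])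

lemma shear_unshear: "J ** J = J \<Longrightarrow> shear J (unshear J S) = S"
  unfolding shear_def unshear_def
  by (simp add: matrix_ring_simps matrix_mul_cong_right[of J J J])

lemma transpose_shear:
  "transpose J = J \<Longrightarrow> transpose S = S \<Longrightarrow> transpose (shear J S) = shear J S"
  and transpose_unshear:
  "transpose J = J \<Longrightarrow> transpose S = S \<Longrightarrow> transpose (unshear J S) = unshear J S"
  unfolding shear_def unshear_def by (simp_all add: matrix_ring_simps)

lemma smooth_on_shear: "smooth_on S f \<Longrightarrow> smooth_on S (\<lambda>x. shear J (f x))"
  unfolding shear_def by (intro smooth_on_diff smooth_on_matrix_mult smooth_on_const)

lemma smooth_on_unshear: "smooth_on S f \<Longrightarrow> smooth_on S (\<lambda>x. unshear J (f x))"
  unfolding unshear_def by (intro smooth_on_add smooth_on_matrix_mult smooth_on_const)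

section \<open>Projections onto graphs in block form\<close>

definition graph_pivot :: "real^'n^'n \<Rightarrow> real^'n^'n \<Rightarrow> real^'n^'n" where
  "graph_pivot J X = J + transpose X ** X - X - transpose X"

lemma smooth_on_graph_pivot: "smooth_on S f \<Longrightarrow> smooth_on S (\<lambda>x. graph_pivot J (f x))"
  unfolding graph_pivot_def
  by (intro smooth_on_add smooth_on_diff smooth_on_matrix_mult smooth_on_const smooth_on_transpose)

context
  fixes J X :: "real^'n^'n"
  assumes J: "transpose J = J" "J ** J = J" and X: "J ** X = 0" "X ** J = X"
begin

lemma graph_transpose: "J ** transpose X = transpose X" "transpose X ** J = 0" "X ** X = 0"
  "transpose X ** transpose X = 0"
proof -
  show 1: "J ** transpose X = transpose X"
    using arg_cong[OF X(2), of transpose] J(1) by (simp add: matrix_transpose_mul)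
  show 2: "transpose X ** J = 0"
    using arg_cong[OF X(1), of transpose] J(1) by (simp add: matrix_transpose_mul transpose_zero)
  show "X ** X = 0"
    by (metis X matrix_mul_assoc matrix_zero_right)
  show "transpose X ** transpose X = 0"
    by (metis 1 2 matrix_mul_assoc matrix_zero_left)
qed

lemmas graph_simps = matrix_ring_simps J X graph_transpose
  J(2)[THEN matrix_mul_cong_right] X[THEN matrix_mul_cong_right]
  graph_transpose[THEN matrix_mul_cong_right]

lemma transpose_graph_pivot: "transpose (graph_pivot J X) = graph_pivot J X"
  unfolding graph_pivot_def by (simp add: graph_simps)

lemma pivot_den_graph_pivot: "pivot_den J (graph_pivot J X) = mat 1 + transpose X ** X - transpose X"
  unfolding pivot_den_def graph_pivot_def by (simp add: graph_simps)

lemma graph_pivot_block: "- ((mat 1 - J) ** graph_pivot J X ** J) = X"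
  unfolding graph_pivot_def by (simp add: graph_simps)

lemma shear_graph_pivot: "shear J (graph_pivot J X) = - X - transpose X"
  unfolding shear_def graph_pivot_def by (simp add: graph_simps)

text \<open>Since \<open>transpose X\<close> squares to zero, multiplication by
  \<open>mat 1 + transpose X\<close> turns the denominator into
  \<open>mat 1 + transpose X ** X\<close>. This is positive definite, with quadratic form
  \<open>|v|^2 + |X v|^2\<close>.\<close>

lemma invertible_pivot_den_graph_pivot: "invertible (pivot_den J (graph_pivot J X))"
proof -
  have "(mat 1 + transpose X) ** pivot_den J (graph_pivot J X) = mat 1 + transpose X ** X"
    unfolding pivot_den_graph_pivot by (simp add: graph_simps)
  moreover have "v = 0" if v: "(mat 1 + transpose X ** X) *v v = 0" for v
  proof -
    have "v \<bullet> v + (X *v v) \<bullet> (X *v v) = v \<bullet> ((mat 1 + transpose X ** X) *v v)"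
      by (simp add: matrix_vector_mult_add_rdistrib matrix_vector_mul_assoc[symmetric]
          inner_add_right dot_lmul_matrix inner_commute del: transpose_matrix_vector)
         (metis dot_lmul_matrix inner_commute transpose_matrix_vector)
    then have "v \<bullet> v + (X *v v) \<bullet> (X *v v) = 0" using v by simp
    then show ?thesis by (smt (verit) inner_ge_zero inner_eq_zero_iff)
  qed
  ultimately have "v = 0" if "pivot_den J (graph_pivot J X) *v v = 0" for v
    using that by (metis matrix_vector_mul_assoc matrix_vector_mult_0_right)
  then show ?thesis
    using matrix_left_invertible_ker invertible_left_inverse by blast
qed

text \<open>The projection as a fraction: the numerator \<open>J + X\<close> parametrises the graph,
  and leaving the denominator uncancelled keeps later computations polynomial.\<close>

lemma pivot_graph_pivot:
  "pivot J (graph_pivot J X) ** (mat 1 + transpose X ** X - transpose X) = J + X"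
proof -
  have "pivot J (graph_pivot J X) ** pivot_den J (graph_pivot J X) = J - (mat 1 - J) ** graph_pivot J X"
    unfolding pivot_def
    by (simp add: matrix_mul_assoc[symmetric] matrix_inv_left[OF invertible_pivot_den_graph_pivot])
  also have "\<dots> = J + X"
    unfolding graph_pivot_def by (simp add: graph_simps)
  finally show ?thesis unfolding pivot_den_graph_pivot .
qed

lemma transpose_pivot_graph_pivot:
  "transpose (pivot J (graph_pivot J X)) = pivot J (graph_pivot J X)"
  by (rule transpose_pivot[OF J transpose_graph_pivot invertible_pivot_den_graph_pivot])

lemma pivot_graph_pivot_idem:
  "pivot J (graph_pivot J X) ** pivot J (graph_pivot J X) = pivot J (graph_pivot J X)"
proof -
  let ?P = "pivot J (graph_pivot J X)" and ?N = "mat 1 + transpose X ** X - transpose X"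
  \<comment> \<open>The denominator fixes \<open>J + X\<close>, and \<open>J + X\<close> is
    idempotent; by the fraction form \<open>?P\<close> then fixes \<open>J + X\<close> too.\<close>
  have "?N ** (J + X) = J + X" by (simp add: graph_simps)
  then have "?P ** (J + X) = ?P ** ?N ** (J + X)"
    by (simp add: matrix_mul_assoc[symmetric])
  also have "\<dots> = J + X"
    unfolding pivot_graph_pivot by (simp add: graph_simps)
  finally have "?P ** ?P ** ?N = ?P ** ?N"
    by (simp add: matrix_mul_assoc[symmetric] pivot_graph_pivot)
  then have "?P ** ?P ** ?N ** matrix_inv ?N = ?P ** ?N ** matrix_inv ?N"
    by simp
  then show ?thesis
    using matrix_inv_right[OF invertible_pivot_den_graph_pivot]
    by (simp add: matrix_mul_assoc[symmetric] pivot_den_graph_pivot)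
qed

lemma range_pivot_graph_pivot:
  "range ((*v) (pivot J (graph_pivot J X))) = range ((*v) (J + X))"
proof -
  let ?P = "pivot J (graph_pivot J X)" and ?N = "mat 1 + transpose X ** X - transpose X"
  have "surj ((*v) ?N)"
    using invertible_pivot_den_graph_pivot invertible_eq_bij unfolding pivot_den_graph_pivot
    by (metis bij_is_surj)
  then have "range ((*v) ?P) = (*v) ?P ` range ((*v) ?N)" by simp
  also have "\<dots> = range ((*v) (J + X))"
    by (simp add: image_image matrix_vector_mul_assoc pivot_graph_pivot)
  finally show ?thesis .
qed

end


section \<open>Orthogonal projections\<close>

definition proj_onto :: "(real^'n) set \<Rightarrow> real^'n^'n \<Rightarrow> bool" where
  "proj_onto W J \<longleftrightarrow> transpose J = J \<and> J ** J = J \<and> range ((*v) J) = W"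

lemma inner_symmetric_matrix:
  fixes J :: "real^'n^'n"
  shows "transpose J = J \<Longrightarrow> (J *v x) \<bullet> y = x \<bullet> (J *v y)"
  by (metis dot_lmul_matrix transpose_matrix_vector)

lemma proj_onto_mem_iff: "proj_onto W J \<Longrightarrow> x \<in> W \<longleftrightarrow> J *v x = x"
  unfolding proj_onto_def by (metis matrix_vector_mul_assoc rangeE rangeI)

lemma proj_onto_apply: "proj_onto W J \<Longrightarrow> J *v x \<in> W"
  unfolding proj_onto_def by blast

lemma proj_onto_comp_iff:
  assumes "proj_onto W J"
  shows "x \<in> orthogonal_comp W \<longleftrightarrow> J *v x = 0"
proof -
  have t: "transpose J = J" and W: "W = range ((*v) J)"
    using assms unfolding proj_onto_def by auto
  have "x \<in> orthogonal_comp W \<longleftrightarrow> (\<forall>z. z \<bullet> (J *v x) = 0)"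
    unfolding orthogonal_comp_def orthogonal_def W by (simp add: inner_symmetric_matrix[OF t])
  also have "\<dots> \<longleftrightarrow> J *v x = 0"
    by (metis inner_eq_zero_iff inner_zero_right)
  finally show ?thesis .
qed

lemma proj_onto_subspace: "proj_onto W J \<Longrightarrow> subspace W"
  unfolding proj_onto_def using linear_subspace_image[OF matrix_vector_mul_linear subspace_UNIV] by blast

text \<open>Equal ranges give \<open>P ** Q = Q\<close> and \<open>Q ** P = P\<close>; transposing
  one of these identifies the two matrices.\<close>

lemma proj_onto_unique:
  assumes "proj_onto W P" "proj_onto W Q"
  shows "P = Q"
proof -
  have "P ** Q = Q" "Q ** P = P"
    using proj_onto_mem_iff[OF assms(1)] proj_onto_apply[OF assms(2)]
      proj_onto_mem_iff[OF assms(2)] proj_onto_apply[OF assms(1)]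
    by (simp_all add: matrix_eq matrix_vector_mul_assoc[symmetric])
  then show ?thesis
    using assms unfolding proj_onto_def by (metis matrix_transpose_mul)
qed

lemma proj_onto_exists:
  fixes W :: "(real^'n) set"
  assumes "subspace W"
  shows "\<exists>J. proj_onto W J"
proof -
  obtain B where B: "B \<subseteq> W" "pairwise orthogonal B" "\<And>x. x \<in> B \<Longrightarrow> norm x = 1"
    "independent B" "span B = W"
    using orthonormal_basis_subspace[OF assms] by metis
  have fin: "finite B" using B(4) by (rule independent_imp_finite)
  define f where "f x = (\<Sum>b\<in>B. (x \<bullet> b) *\<^sub>R b)" for x
  have lin: "linear f"
    unfolding f_def
    by (rule linearI) (simp_all add: inner_add_left scaleR_add_left sum.distrib scaleR_sum_right)
  have fW: "f x \<in> W" for x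
    unfolding f_def B(5)[symmetric] by (intro span_sum span_scale span_base)
  have fix_W: "f x = x" if "x \<in> W" for x
    unfolding f_def using orthonormal_basis_expand[OF B(2,3)] that fin B(5) by blast
  have m: "matrix f *v x = f x" for x
    by (rule matrix_works[OF lin[unfolded linear_matrix_vector_mul_eq[symmetric]]])
  have "transpose (matrix f) = matrix f"
    by (simp add: transpose_def matrix_def vec_eq_iff f_def inner_axis_axis inner_axis' sum_component
        mult.commute)
  moreover have "matrix f ** matrix f = matrix f"
    by (simp add: matrix_eq matrix_vector_mul_assoc[symmetric] m fix_W fW)
  moreover have "range ((*v) (matrix f)) = W"
  proof (intro equalityI subsetI)
    show "x \<in> range ((*v) (matrix f))" if "x \<in> W" for x
      using rangeI[of "(*v) (matrix f)" x] by (simp add: m fix_W that)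
  qed (auto simp: m fW)
  ultimately show ?thesis unfolding proj_onto_def by blast
qed

definition proj_matrix :: "(real^'n) set \<Rightarrow> real^'n^'n" where
  "proj_matrix W = (SOME J. proj_onto W J)"

lemma proj_onto_proj_matrix: "subspace W \<Longrightarrow> proj_onto W (proj_matrix W)"
  unfolding proj_matrix_def by (rule someI_ex[OF proj_onto_exists])

lemma proj_matrix_eq: "proj_onto W J \<Longrightarrow> proj_matrix W = J"
  using proj_onto_unique proj_onto_proj_matrix proj_onto_subspace by blast

lemma dim_orthogonal_comp:
  fixes W :: "(real^'n) set"
  assumes "subspace W"
  shows "dim (orthogonal_comp W) = CARD('n) - dim W"
  using dim_subspace_orthogonal_to_vectors[OF assms subspace_UNIV subset_UNIV]
  by (simp add: orthogonal_comp_def)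

section \<open>Reflections\<close>

definition reflection :: "(real^'n) set \<Rightarrow> real^'n^'n" where
  "reflection W = 2 *\<^sub>R proj_matrix W - mat 1"

definition half_sum :: "real^'n^'n \<Rightarrow> real^'n^'n" where
  "half_sum B = (1 / 2) *\<^sub>R (B + mat 1)"

lemma half_sum_inverse: "half_sum (2 *\<^sub>R P - mat 1) = P" "2 *\<^sub>R half_sum B - mat 1 = B"
  unfolding half_sum_def by simp_all

lemma transpose_half_sum: "transpose (half_sum B) = half_sum B \<longleftrightarrow> transpose B = B"
  unfolding half_sum_def by (simp add: transpose_scalar transpose_add)

lemma smooth_on_half_sum: "smooth_on S f \<Longrightarrow> smooth_on S (\<lambda>x. half_sum (f x))"
  unfolding half_sum_def
  by (intro smooth_on_bilinear[OF bounded_bilinear_scaleR] smooth_on_add smooth_on_const)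

lemma smooth_on_double: "smooth_on S f \<Longrightarrow> smooth_on S (\<lambda>x. 2 *\<^sub>R f x - mat 1 :: real^'n^'n)"
  by (intro smooth_on_bilinear[OF bounded_bilinear_scaleR] smooth_on_diff smooth_on_const)

lemma half_sum_reflection: "half_sum (reflection W) = proj_matrix W"
  unfolding reflection_def by (rule half_sum_inverse)

lemma matrix_scaleR_mult:
  fixes A :: "real^'n^'m" and B :: "real^'k^'n"
  shows "(c *\<^sub>R A) ** B = c *\<^sub>R (A ** B)" "A ** (c *\<^sub>R B) = c *\<^sub>R (A ** B)"
  by (simp_all add: vec_eq_iff matrix_matrix_mult_def sum_distrib_left mult_ac)

text \<open>Idempotence of the projection \<open>P\<close> makes \<open>2 P - 1\<close> an
  involution, and the fixed space and the kernel of \<open>P\<close> are its eigenspaces for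
  \<open>1\<close> and \<open>-1\<close>.\<close>

lemma reflection_in_symmetric_orthogonal:
  fixes W :: "(real^'n) set"
  assumes "W \<in> grassmannian p"
  shows "reflection W \<in> symmetric_orthogonal_matrices p (CARD('n) - p)"
proof -
  have W: "subspace W" "dim W = p" using assms unfolding grassmannian_def by auto
  let ?P = "proj_matrix W"
  have P: "proj_onto W ?P" by (rule proj_onto_proj_matrix[OF W(1)])
  then have t: "transpose ?P = ?P" and i: "?P ** ?P = ?P" unfolding proj_onto_def by auto
  have tR: "transpose (reflection W) = reflection W"
    unfolding reflection_def by (simp add: transpose_scalar transpose_diff t)
  have "reflection W ** reflection W = mat 1"
    unfolding reflection_def
    by (simp add: matrix_ring_simps matrix_scaleR_mult i) (simp add: vec_eq_iff)
  then have "orthogonal_matrix (reflection W)"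
    unfolding orthogonal_matrix_def tR by simp
  moreover have "{x. reflection W *v x = 1 *\<^sub>R x} = W"
    unfolding reflection_def
    by (auto simp: matrix_vector_mult_diff_rdistrib proj_onto_mem_iff[OF P] algebra_simps
        scaleR_matrix_vector_assoc[symmetric] scaleR_2[symmetric])
  moreover have "{x. reflection W *v x = (-1) *\<^sub>R x} = orthogonal_comp W"
    unfolding reflection_def
    by (auto simp: matrix_vector_mult_diff_rdistrib proj_onto_comp_iff[OF P]
        scaleR_matrix_vector_assoc[symmetric])
  ultimately show ?thesis
    unfolding symmetric_orthogonal_matrices_def eigenvalue_multiplicity_def symmetric_matrices_def
    using tR W dim_orthogonal_comp[OF W(1)] by simp
qed

text \<open>Symmetry and orthogonality give \<open>B ** B = mat 1\<close>, which makes
  \<open>half_sum B\<close> idempotent with the same fixed vectors as \<open>B\<close>.\<close>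

lemma symmetric_orthogonal_is_reflection:
  fixes B :: "real^'n^'n"
  assumes "B \<in> symmetric_orthogonal_matrices p q"
  obtains W where "W \<in> grassmannian p" "B = reflection W"
proof -
  have B: "transpose B = B" "B ** B = mat 1" "dim {x. B *v x = x} = p"
    using assms
    unfolding symmetric_orthogonal_matrices_def eigenvalue_multiplicity_def symmetric_matrices_def
      orthogonal_matrix_def by auto
  let ?W = "{x. B *v x = x}"
  have i: "half_sum B ** half_sum B = half_sum B"
    unfolding half_sum_def
    by (simp add: matrix_ring_simps matrix_scaleR_mult B(2) scaleR_add_right[symmetric])
       (simp add: vec_eq_iff)
  have fixed: "half_sum B *v x = x \<longleftrightarrow> B *v x = x" for x
  proof -
    have "B *v x = 2 *\<^sub>R (half_sum B *v x) - x"
      by (subst (1) half_sum_inverse(2)[of B, symmetric])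
         (simp only: matrix_vector_mult_diff_rdistrib scaleR_matrix_vector_assoc[symmetric] matrix_vector_mul_lid)
    moreover have "2 *\<^sub>R y - x = x \<longleftrightarrow> y = x" for y
      by (metis diff_eq_eq scaleR_2 scaleR_cancel_left zero_neq_numeral)
    ultimately show ?thesis by metis
  qed
  have "range ((*v) (half_sum B)) = ?W"
  proof (intro equalityI subsetI CollectI)
    show "B *v x = x" if "x \<in> range ((*v) (half_sum B))" for x
      using that i fixed[of x] matrix_vector_mul_assoc[of "half_sum B" "half_sum B"] by (metis rangeE)
    show "x \<in> range ((*v) (half_sum B))" if "x \<in> ?W" for x
    proof -
      have "half_sum B *v x = x" using that fixed[of x] by simp
      then show ?thesis using rangeI[of "(*v) (half_sum B)" x] by simp
    qed
  qed
  then have P: "proj_onto ?W (half_sum B)"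
    unfolding proj_onto_def using B(1) i by (simp add: transpose_half_sum)
  have "reflection ?W = B"
    unfolding reflection_def proj_matrix_eq[OF P] by (rule half_sum_inverse(2))
  moreover have "?W \<in> grassmannian p"
    using proj_onto_subspace[OF P] B(3) unfolding grassmannian_def by simp
  ultimately show ?thesis using that by metis
qed

lemma proj_matrix_inj:
  assumes "subspace V" "subspace W" "proj_matrix V = proj_matrix W"
  shows "V = W"
  using proj_onto_proj_matrix[OF assms(1)] proj_onto_proj_matrix[OF assms(2)] assms(3)
  unfolding proj_onto_def by metis

lemma bij_betw_reflection:
  "bij_betw reflection (grassmannian p)
     (symmetric_orthogonal_matrices p (CARD('n) - p) :: (real^'n^'n) set)"
  unfolding bij_betw_def
proof
  show "inj_on reflection (grassmannian p :: (real^'n) set set)"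
    by (rule inj_onI) (metis (mono_tags) grassmannian_def half_sum_reflection mem_Collect_eq proj_matrix_inj)
  show "reflection ` grassmannian p = (symmetric_orthogonal_matrices p (CARD('n) - p) :: (real^'n^'n) set)"
    by (auto intro: reflection_in_symmetric_orthogonal elim: symmetric_orthogonal_is_reflection)
qed

section \<open>Graph coordinates\<close>

text \<open>Vectors of \<open>W\<close> have the form \<open>J *v x\<close> and those of the
  complement the form \<open>x - J *v x\<close>. The conditions thus read
  \<open>J ** X ** J = 0\<close> and \<open>X ** J = X\<close>, and the second shortens the
  first.\<close>

lemma hom_complement_iff:
  assumes "proj_onto W J"
  shows "X \<in> hom_complement W \<longleftrightarrow> J ** X = 0 \<and> X ** J = X"
proof -
  have i: "J ** J = J" using assms unfolding proj_onto_def by blast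
  have "X \<in> hom_complement W \<longleftrightarrow> (\<forall>x. J *v (X *v (J *v x)) = 0) \<and> (\<forall>x. X *v (x - J *v x) = 0)"
  proof -
    have "(\<forall>x\<in>W. X *v x \<in> orthogonal_comp W) \<longleftrightarrow> (\<forall>x. J *v (X *v (J *v x)) = 0)"
      using proj_onto_mem_iff[OF assms] proj_onto_apply[OF assms] proj_onto_comp_iff[OF assms] by metis
    moreover have "(\<forall>x\<in>orthogonal_comp W. X *v x = 0) \<longleftrightarrow> (\<forall>x. X *v (x - J *v x) = 0)"
    proof -
      have "J *v (x - J *v x) = 0" for x
        by (simp add: matrix_vector_mult_diff_distrib matrix_vector_mul_assoc i)
      then show ?thesis
        using proj_onto_comp_iff[OF assms] by (metis diff_zero)
    qed
    ultimately show ?thesis unfolding hom_complement_def by simp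
  qed
  also have "\<dots> \<longleftrightarrow> J ** X ** J = 0 \<and> X ** J = X"
    by (auto simp: matrix_eq matrix_vector_mul_assoc[symmetric] matrix_vector_mult_diff_distrib)
  also have "\<dots> \<longleftrightarrow> J ** X = 0 \<and> X ** J = X"
    by (metis matrix_mul_assoc matrix_zero_left)
  finally show ?thesis .
qed

lemma hom_complementD:
  assumes "proj_onto W J" "X \<in> hom_complement W"
  shows "transpose J = J" "J ** J = J" "J ** X = 0" "X ** J = X"
  using assms hom_complement_iff[OF assms(1)] unfolding proj_onto_def by auto

text \<open>Since \<open>X = X ** J\<close>, the matrix \<open>J + X\<close> sends \<open>x\<close>
  to the point of the graph above \<open>J *v x\<close>, and its range is that of the pivot.\<close>

lemma proj_onto_graph_over:
  assumes "proj_onto W J" "X \<in> hom_complement W"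
  shows "proj_onto (graph_over W X) (pivot J (graph_pivot J X))"
proof -
  note X = hom_complementD[OF assms]
  have "range ((*v) (J + X)) = graph_over W X"
  proof -
    have "(J + X) *v x = J *v x + X *v (J *v x)" for x
      by (simp add: matrix_vector_mult_add_rdistrib matrix_vector_mul_assoc X(4))
    moreover have "W = range ((*v) J)" using assms(1) unfolding proj_onto_def by simp
    ultimately show ?thesis unfolding graph_over_def by auto
  qed
  then show ?thesis
    unfolding proj_onto_def
    using transpose_pivot_graph_pivot[OF X] pivot_graph_pivot_idem[OF X] range_pivot_graph_pivot[OF X]
    by simp
qed

lemma proj_matrix_graph_over:
  assumes "proj_onto W J" "X \<in> hom_complement W"
  shows "proj_matrix (graph_over W X) = pivot J (graph_pivot J X)"
  by (rule proj_matrix_eq[OF proj_onto_graph_over[OF assms]])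

lemma pivot_proj_matrix_graph_over:
  assumes "proj_onto W J" "X \<in> hom_complement W"
  shows "pivot J (proj_matrix (graph_over W X)) = graph_pivot J X"
    and "invertible (pivot_den J (proj_matrix (graph_over W X)))"
proof -
  note X = hom_complementD[OF assms]
  show "pivot J (proj_matrix (graph_over W X)) = graph_pivot J X"
    unfolding proj_matrix_graph_over[OF assms]
    by (rule pivot_pivot[OF X(2) invertible_pivot_den_graph_pivot[OF X]])
  show "invertible (pivot_den J (proj_matrix (graph_over W X)))"
    unfolding proj_matrix_graph_over[OF assms]
    by (rule invertible_pivot_den_pivot[OF X(2) invertible_pivot_den_graph_pivot[OF X]])
qed

text \<open>The projection onto the graph determines \<open>X\<close>, as the negated lower left
  block of its pivot.\<close>

lemma graph_over_inject:
  assumes "proj_onto W J" "X \<in> hom_complement W" "Y \<in> hom_complement W"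
    and "graph_over W X = graph_over W Y"
  shows "X = Y"
  using pivot_proj_matrix_graph_over(1)[OF assms(1,2)] pivot_proj_matrix_graph_over(1)[OF assms(1,3)]
    graph_pivot_block[OF hom_complementD[OF assms(1,2)]] graph_pivot_block[OF hom_complementD[OF assms(1,3)]]
    assms(4) by metis

text \<open>On the graph, \<open>J\<close> undoes the map \<open>x \<mapsto> x + X *v x\<close>.
  This gives both the dimension and the trivial intersection with the kernel of
  \<open>J\<close>.\<close>

lemma graph_over_in_grassmannian:
  assumes "proj_onto W J" "X \<in> hom_complement W" "dim W = p"
  shows "graph_over W X \<in> grassmannian p" "graph_over W X \<inter> orthogonal_comp W = {0}"
proof -
  have W: "subspace W" by (rule proj_onto_subspace[OF assms(1)])
  have J: "J *v (x + X *v x) = x" if "x \<in> W" for x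
    using that proj_onto_mem_iff[OF assms(1)] hom_complementD(3)[OF assms(1,2)]
    by (simp add: matrix_vector_right_distrib matrix_vector_mul_assoc)
  have "graph_over W X = (\<lambda>x. x + X *v x) ` W"
    unfolding graph_over_def by auto
  moreover have "linear (\<lambda>x. x + X *v x)"
    by (intro linear_compose_add linear_ident matrix_vector_mul_linear)
  moreover have "inj_on (\<lambda>x. x + X *v x) W"
    by (rule inj_on_inverseI[where g = "(*v) J"]) (rule J)
  ultimately have "dim (graph_over W X) = p"
    using dim_image_eq[of "\<lambda>x. x + X *v x" W] W assms(3) by (metis span_eq_iff)
  then show "graph_over W X \<in> grassmannian p"
    unfolding grassmannian_def using proj_onto_subspace[OF proj_onto_graph_over[OF assms(1,2)]] by simp
  have "x + X *v x = 0" if "x \<in> W" "x + X *v x \<in> orthogonal_comp W" for x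
    using that J proj_onto_comp_iff[OF assms(1)] by simp
  moreover have "0 \<in> graph_over W X"
    by (rule subspace_0[OF proj_onto_subspace[OF proj_onto_graph_over[OF assms(1,2)]]])
  ultimately show "graph_over W X \<inter> orthogonal_comp W = {0}"
    using proj_onto_comp_iff[OF assms(1), of 0] unfolding graph_over_def by auto
qed

text \<open>The complement of \<open>W\<close> is the kernel of \<open>J\<close>, so
  \<open>J\<close> is injective on \<open>V\<close> and, by dimension, maps it onto
  \<open>W\<close>. Inverting this restriction presents \<open>V\<close> as a graph.\<close>

lemma graph_over_exists:
  assumes "proj_onto W J" "dim W = p" "V \<in> grassmannian p" "V \<inter> orthogonal_comp W = {0}"
  shows "\<exists>X\<in>hom_complement W. V = graph_over W X"
proof -
  have V: "subspace V" "dim V = dim W" using assms unfolding grassmannian_def by auto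
  have W: "subspace W" by (rule proj_onto_subspace[OF assms(1)])
  have lin: "linear ((*v) J)" by simp
  have inj: "inj_on ((*v) J) V"
    unfolding linear_inj_on_iff_eq_0[OF lin V(1)]
    using assms(4) proj_onto_comp_iff[OF assms(1)] by blast
  have "(*v) J ` V = W"
  proof (rule subspace_dim_equal)
    show "dim ((*v) J ` V) \<ge> dim W"
      using dim_image_eq[OF lin] inj V by (metis order_refl span_eq_iff)
  qed (use W linear_subspace_image[OF lin V(1)] proj_onto_apply[OF assms(1)] in auto)
  obtain g where g: "g ` UNIV \<subseteq> V" "linear g" "\<And>v. v \<in> V \<Longrightarrow> g (J *v v) = v"
    using linear_exists_left_inverse_on[OF lin V(1) inj] by blast
  \<comment> \<open>Precomposition with \<open>J\<close> extends the map by zero to the complement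
    of \<open>W\<close>.\<close>
  define X where "X = matrix (\<lambda>x. g (J *v x) - J *v x)"
  have "linear (\<lambda>x. g (J *v x) - J *v x)"
    by (intro linear_compose_sub linear_compose[OF lin g(2), unfolded o_def] lin)
  then have X: "X *v x = g (J *v x) - J *v x" for x
    unfolding X_def linear_matrix_vector_mul_eq[symmetric] by (rule matrix_works)
  have JX: "J *v g w = w" if "w \<in> W" for w
    using that \<open>(*v) J ` V = W\<close> g(3) by force
  have "X \<in> hom_complement W"
  proof -
    have "J *v (J *v x) = J *v x" for x
      using proj_onto_apply[OF assms(1)] proj_onto_mem_iff[OF assms(1)] by blast
    then show ?thesis
      unfolding hom_complement_iff[OF assms(1)]
      by (simp add: matrix_eq matrix_vector_mul_assoc[symmetric] X matrix_vector_mult_diff_distrib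
          JX[OF proj_onto_apply[OF assms(1)]])
  qed
  moreover have "graph_over W X = V"
  proof -
    have "x + X *v x = g x" if "x \<in> W" for x
      using that proj_onto_mem_iff[OF assms(1)] by (simp add: X)
    then have "graph_over W X = g ` W" unfolding graph_over_def by force
    also have "\<dots> = V" using \<open>(*v) J ` V = W\<close> g(3) by (force simp: image_iff)
    finally show ?thesis .
  qed
  ultimately show ?thesis by blast
qed


lemma dim_image_subspace:
  fixes f :: "'a::euclidean_space \<Rightarrow> 'b::euclidean_space"
  assumes "linear f" "subspace S" "inj_on f S"
  shows "dim (f ` S) = dim S"
  using dim_image_eq[OF assms(1)] assms(2,3) by (metis span_eq_iff)

section \<open>The Grassmannian\<close>

lemma chart_map_graph_over:
  assumes "proj_onto W J" "X \<in> hom_complement W"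
  shows "chart_map (grassmannian_chart p W) (graph_over W X) = X"
  unfolding grassmannian_chart_def chart.sel
  by (rule the_equality) (use assms graph_over_inject[OF assms(1)] in auto)

lemma chart_dom_grassmannian_chart:
  assumes "proj_onto W J" "dim W = p"
  shows "chart_dom (grassmannian_chart p W) = graph_over W ` hom_complement W"
proof (intro equalityI subsetI)
  fix V assume "V \<in> chart_dom (grassmannian_chart p W)"
  then have "V \<in> grassmannian p" "V \<inter> orthogonal_comp W = {0}"
    unfolding grassmannian_chart_def by auto
  from graph_over_exists[OF assms this] show "V \<in> graph_over W ` hom_complement W" by blast
next
  fix V assume "V \<in> graph_over W ` hom_complement W"
  then obtain X where "X \<in> hom_complement W" "V = graph_over W X" by blast
  then show "V \<in> chart_dom (grassmannian_chart p W)"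
    using graph_over_in_grassmannian[OF assms(1) _ assms(2)] unfolding grassmannian_chart_def by simp
qed

text \<open>On \<open>W\<close> the denominator acts as \<open>J\<close> after
  \<open>proj_matrix V\<close>. Its invertibility makes this projection injective on
  \<open>W\<close>, hence, by dimension, a map of \<open>W\<close> onto \<open>V\<close>; a vector
  of \<open>V\<close> killed by \<open>J\<close> then comes from \<open>0\<close>.\<close>

lemma invertible_pivot_den_imp_graph:
  assumes W: "proj_onto W J" "dim W = p" and V: "V \<in> grassmannian p"
    and inv: "invertible (pivot_den J (proj_matrix V))"
  shows "V \<in> graph_over W ` hom_complement W"
proof -
  let ?P = "proj_matrix V"
  have sV: "subspace V" "dim V = dim W" using V W(2) unfolding grassmannian_def by auto
  have sW: "subspace W" by (rule proj_onto_subspace[OF W(1)])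
  have P: "proj_onto V ?P" by (rule proj_onto_proj_matrix[OF sV(1)])
  have ker: "w = 0" if "w \<in> W" "J *v (?P *v w) = 0" for w
  proof -
    have "pivot_den J ?P *v w = w - J *v w + J *v (?P *v w)"
      unfolding pivot_den_def
      by (simp add: matrix_vector_mult_add_rdistrib matrix_vector_mult_diff_rdistrib matrix_vector_mul_assoc)
    then have "pivot_den J ?P *v w = 0"
      using that proj_onto_mem_iff[OF W(1)] by simp
    then show ?thesis
      using inv invertible_left_inverse matrix_left_invertible_ker by metis
  qed
  have lin: "linear ((*v) ?P)" by simp
  have "inj_on ((*v) ?P) W"
    unfolding linear_inj_on_iff_eq_0[OF lin sW] using ker by (metis matrix_vector_mult_0_right)
  then have d: "dim ((*v) ?P ` W) = dim V"
    using dim_image_subspace[OF lin sW] sV(2) by simp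
  have "(*v) ?P ` W = V"
  proof (rule subspace_dim_equal)
    show "dim V \<le> dim ((*v) ?P ` W)" using d by simp
  qed (use sV linear_subspace_image[OF lin sW] proj_onto_apply[OF P] in auto)
  then have "v = 0" if "v \<in> V" "v \<in> orthogonal_comp W" for v
    using that ker proj_onto_comp_iff[OF W(1)] by (metis imageE matrix_vector_mult_0_right)
  then have "V \<inter> orthogonal_comp W = {0}"
    using subspace_0[OF sV(1)] subspace_0[OF subspace_orthogonal_comp] by blast
  then show ?thesis using graph_over_exists[OF W V] by blast
qed

lemma invertible_pivot_den_iff_graph:
  assumes "proj_onto W J" "dim W = p" "V \<in> grassmannian p"
  shows "invertible (pivot_den J (proj_matrix V)) \<longleftrightarrow> V \<in> graph_over W ` hom_complement W"
  using invertible_pivot_den_imp_graph[OF assms] pivot_proj_matrix_graph_over(2)[OF assms(1)] by blast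

lemma subspace_hom_complement:
  assumes "proj_onto W J"
  shows "subspace (hom_complement W)"
  unfolding subspace_def
  by (simp add: hom_complement_iff[OF assms] matrix_ring_simps matrix_scaleR_mult)

lemma reflection_graph_over:
  assumes "proj_onto W J" "X \<in> hom_complement W"
  shows "reflection (graph_over W X) = 2 *\<^sub>R pivot J (graph_pivot J X) - mat 1"
  unfolding reflection_def proj_matrix_graph_over[OF assms] ..

lemma compatible_grassmannian_chart:
  fixes W :: "(real^'n) set"
  assumes W: "W \<in> grassmannian p"
  shows "compatible_chart (symmetric_orthogonal_matrices p (CARD('n) - p)) (dim (hom_complement W))
    reflection (grassmannian_chart p W)"
proof -
  define J where "J = proj_matrix W"
  let ?M = "symmetric_orthogonal_matrices p (CARD('n) - p) :: (real^'n^'n) set"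
  let ?D = "graph_over W ` hom_complement W"
  have p: "dim W = p" and J: "proj_onto W J"
    using W proj_onto_proj_matrix unfolding J_def grassmannian_def by auto
  have dom: "chart_dom (grassmannian_chart p W) = ?D"
    by (rule chart_dom_grassmannian_chart[OF J p])
  have img: "chart_map (grassmannian_chart p W) ` ?D = hom_complement W"
    using chart_map_graph_over[OF J] by (force simp: image_iff)
  \<comment> \<open>Both the openness of the chart domain in \<open>?M\<close> and the smoothness of
    the pivot on it rest on this description.\<close>
  have fD: "reflection ` ?D = ?M \<inter> {B. invertible (pivot_den J (half_sum B))}"
  proof (intro equalityI subsetI)
    fix B assume "B \<in> reflection ` ?D"
    then obtain V where V: "V \<in> ?D" "B = reflection V" by blast
    then have "V \<in> grassmannian p" using graph_over_in_grassmannian(1)[OF J _ p] by blast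
    then show "B \<in> ?M \<inter> {B. invertible (pivot_den J (half_sum B))}"
      using invertible_pivot_den_iff_graph[OF J p] reflection_in_symmetric_orthogonal V
      by (simp add: half_sum_reflection)
  next
    fix B assume B: "B \<in> ?M \<inter> {B. invertible (pivot_den J (half_sum B))}"
    then obtain V where V: "V \<in> grassmannian p" "B = reflection V"
      using symmetric_orthogonal_is_reflection by blast
    then show "B \<in> reflection ` ?D"
      using invertible_pivot_den_iff_graph[OF J p V(1)] B by (simp add: half_sum_reflection)
  qed
  have \<kappa>: "- ((mat 1 - J) ** pivot J (half_sum (reflection V)) ** J) = chart_map (grassmannian_chart p W) V"
    if V: "V \<in> ?D" for V
  proof -
    obtain X where X: "X \<in> hom_complement W" "V = graph_over W X" using V by blast
    show ?thesis
      unfolding half_sum_reflection X(2) pivot_proj_matrix_graph_over(1)[OF J X(1)]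
        chart_map_graph_over[OF J X(1)]
      by (rule graph_pivot_block[OF hom_complementD[OF J X(1)]])
  qed
  have \<psi>: "2 *\<^sub>R pivot J (graph_pivot J (chart_map (grassmannian_chart p W) V)) - mat 1 = reflection V"
    if V: "V \<in> ?D" for V
    using V by (auto simp: reflection_graph_over[OF J] chart_map_graph_over[OF J])
  have smooth_\<kappa>: "smooth_on (reflection ` ?D) (\<lambda>B. - ((mat 1 - J) ** pivot J (half_sum B) ** J))"
    unfolding fD
    by (intro smooth_on_minus smooth_on_matrix_mult smooth_on_const smooth_on_pivot smooth_on_half_sum
          smooth_on_id) simp
  have smooth_\<psi>: "smooth_on (hom_complement W) (\<lambda>X. 2 *\<^sub>R pivot J (graph_pivot J X) - mat 1)"
    by (intro smooth_on_double smooth_on_pivot smooth_on_graph_pivot smooth_on_id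
          invertible_pivot_den_graph_pivot hom_complementD[OF J])
  have "openin (top_of_set ?M) (reflection ` ?D)"
    unfolding fD
    by (intro openin_open_Int open_invertible_pivot_den smooth_on_half_sum smooth_on_id)
  moreover have "chart_model (grassmannian_chart p W) = hom_complement W"
    unfolding grassmannian_chart_def by simp
  ultimately show ?thesis
    unfolding compatible_chart_def dom img
    using subspace_hom_complement[OF J] smooth_\<kappa> smooth_\<psi> \<kappa> \<psi> by (auto intro!: exI)
qed

text \<open>Isometries of \<open>W\<close> with \<open>W'\<close> and of their complements carry one
  space of homomorphisms injectively into the other.\<close>

lemma dim_hom_complement_le:
  fixes W W' :: "(real^'n) set"
  assumes W: "subspace W" and W': "subspace W'" and d: "dim W = dim W'"
  shows "dim (hom_complement W) \<le> dim (hom_complement W')"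
proof -
  obtain J J' where J: "proj_onto W J" and J': "proj_onto W' J'"
    using proj_onto_exists W W' by metis
  obtain f g where fg: "linear f" "linear g" "f ` W = W'" "\<And>x. x \<in> W \<Longrightarrow> g (f x) = x"
    using isometries_subspaces[OF W W' d] by metis
  have "dim (orthogonal_comp W) = dim (orthogonal_comp W')"
    using d by (simp add: dim_orthogonal_comp W W')
  then obtain k l where kl: "linear k" "linear l" "k ` orthogonal_comp W = orthogonal_comp W'"
    "\<And>x. x \<in> orthogonal_comp W \<Longrightarrow> l (k x) = x"
    using isometries_subspaces[OF subspace_orthogonal_comp subspace_orthogonal_comp] by metis
  have mg: "matrix g *v x = g x" and mk: "matrix k *v x = k x" for x
    using fg(2) kl(1) unfolding linear_matrix_vector_mul_eq[symmetric] by (simp_all add: matrix_works)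
  \<comment> \<open>Here \<open>g\<close> leads from \<open>W'\<close> back to \<open>W\<close> and
    \<open>k\<close> from one complement to the other; the factor \<open>J'\<close> makes the result
    vanish on the complement of \<open>W'\<close>.\<close>
  define h where "h X = matrix k ** X ** matrix g ** J'" for X
  have h: "h X *v x = k (X *v g (J' *v x))" for X x
    unfolding h_def by (simp add: matrix_vector_mul_assoc[symmetric] mg mk)
  have lin: "linear h"
    by (rule linearI) (simp_all add: h_def matrix_ring_simps matrix_scaleR_mult)
  have comp: "X *v x \<in> orthogonal_comp W" if "X \<in> hom_complement W" for X x
    unfolding proj_onto_comp_iff[OF J]
    by (simp add: matrix_vector_mul_assoc hom_complementD(3)[OF J that])
  have "h X \<in> hom_complement W'" if X: "X \<in> hom_complement W" for X
  proof -
    have "J' ** J' = J'" using J' unfolding proj_onto_def by blast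
    then have "h X ** J' = h X" unfolding h_def by (simp add: matrix_mul_assoc[symmetric])
    moreover have "h X *v x \<in> orthogonal_comp W'" for x
      unfolding h using comp[OF X] kl(3) by blast
    then have "J' ** h X = 0"
      by (simp add: matrix_eq matrix_vector_mul_assoc[symmetric] proj_onto_comp_iff[OF J'])
    ultimately show ?thesis unfolding hom_complement_iff[OF J'] by blast
  qed
  then have "h ` hom_complement W \<subseteq> hom_complement W'" by blast
  moreover have "inj_on h (hom_complement W)"
    unfolding linear_inj_on_iff_eq_0[OF lin subspace_hom_complement[OF J]]
  proof (intro ballI impI)
    fix X assume X: "X \<in> hom_complement W" "h X = 0"
    have "X *v (J *v x) = 0" for x
    proof -
      let ?w = "J *v x"
      have w: "?w \<in> W" by (rule proj_onto_apply[OF J])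
      then have "J' *v f ?w = f ?w" using fg(3) proj_onto_mem_iff[OF J'] by blast
      then have "k (X *v ?w) = 0" using h[of X "f ?w"] X(2) fg(4)[OF w] by simp
      then show ?thesis using kl(4)[OF comp[OF X(1), of ?w]] linear_0[OF kl(2)] by simp
    qed
    then have "X ** J = 0" by (simp add: matrix_eq matrix_vector_mul_assoc[symmetric])
    then show "X = 0" using hom_complementD(4)[OF J X(1)] by simp
  qed
  then have "dim (h ` hom_complement W) = dim (hom_complement W)"
    by (rule dim_image_subspace[OF lin subspace_hom_complement[OF J]])
  ultimately show ?thesis by (metis dim_subset)
qed

lemma dim_hom_complement_eq:
  fixes W W' :: "(real^'n) set"
  assumes "W \<in> grassmannian p" "W' \<in> grassmannian p"
  shows "dim (hom_complement W) = dim (hom_complement W')"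
  using assms dim_hom_complement_le[of W W'] dim_hom_complement_le[of W' W]
  unfolding grassmannian_def by auto

lemma compatible_grassmannian_atlas:
  fixes W :: "(real^'n) set"
  assumes "W \<in> grassmannian p"
  shows "compatible_atlas (symmetric_orthogonal_matrices p (CARD('n) - p)) (dim (hom_complement W))
    reflection (grassmannian_atlas p :: ((real^'n) set, real^'n^'n) chart set)"
  unfolding compatible_atlas_def atlas_carrier_grassmannian
proof (intro conjI ballI)
  fix c :: "((real^'n) set, real^'n^'n) chart" assume "c \<in> grassmannian_atlas p"
  then obtain V where "V \<in> grassmannian p" "c = grassmannian_chart p V"
    unfolding grassmannian_atlas_def by blast
  then show "compatible_chart (symmetric_orthogonal_matrices p (CARD('n) - p)) (dim (hom_complement W))
      reflection c"
    using compatible_grassmannian_chart[of V p] dim_hom_complement_eq[OF assms, of V] by simp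
qed (rule bij_betw_reflection)

section \<open>The submanifold of symmetric orthogonal matrices\<close>

lemma subspace_symmetric_matrices: "subspace symmetric_matrices"
  unfolding subspace_def symmetric_matrices_def
  by (simp add: transpose_add transpose_scalar transpose_zero)

text \<open>For an orthogonal projection \<open>J\<close>, these are the symmetric matrices with
  vanishing diagonal blocks, written with the signs that the pivot produces.\<close>

definition off_diagonal :: "real^'n^'n \<Rightarrow> (real^'n^'n) set" where
  "off_diagonal J = (\<lambda>X. - X - transpose X) ` {X. J ** X = 0 \<and> X ** J = X}"

lemma off_diagonal_subspace:
  assumes "proj_onto W J"
  shows "subspace (off_diagonal J)" "off_diagonal J \<subseteq> symmetric_matrices"
    "dim (off_diagonal J) = dim (hom_complement W)"
proof -
  have H: "{X. J ** X = 0 \<and> X ** J = X} = hom_complement W"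
    using hom_complement_iff[OF assms] by blast
  have lin: "linear (\<lambda>X :: real^'n^'n. - X - transpose X)"
    by (rule linearI) (simp_all add: transpose_add transpose_scalar scaleR_diff_right)
  show "subspace (off_diagonal J)"
    unfolding off_diagonal_def H by (rule linear_subspace_image[OF lin subspace_hom_complement[OF assms]])
  show "off_diagonal J \<subseteq> symmetric_matrices"
    unfolding off_diagonal_def symmetric_matrices_def by (auto simp: transpose_diff transpose_minus)
  have "inj_on (\<lambda>X. - X - transpose X) (hom_complement W)"
    unfolding linear_inj_on_iff_eq_0[OF lin subspace_hom_complement[OF assms]]
  proof (intro ballI impI)
    fix X assume X: "X \<in> hom_complement W" "- X - transpose X = 0"
    note XJ = hom_complementD[OF assms X(1)]
    \<comment> \<open>The two summands lie in different blocks, and \<open>J\<close> on the left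
      keeps only the second.\<close>
    have "J ** (- X - transpose X) = - transpose X"
      by (simp add: matrix_ring_simps XJ graph_transpose[OF XJ])
    then show "X = 0"
      using X(2) by (metis matrix_zero_right neg_equal_0_iff_equal transpose_transpose transpose_zero)
  qed
  then show "dim (off_diagonal J) = dim (hom_complement W)"
    unfolding off_diagonal_def H
    by (rule dim_image_subspace[OF lin subspace_hom_complement[OF assms]])
qed

text \<open>The image is cut out by the same invertibility condition after undoing the shear,
  because the pivot replaces a denominator by its inverse.\<close>

lemma slice_chart_symmetric_orthogonal:
  fixes W :: "(real^'n) set"
  assumes W: "W \<in> grassmannian p" and J: "proj_onto W J"
  shows "slice_chart symmetric_matrices (dim (hom_complement W))
    (symmetric_orthogonal_matrices p (CARD('n) - p))
    (symmetric_matrices \<inter> {B. invertible (pivot_den J (half_sum B))})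
    (\<lambda>B. shear J (pivot J (half_sum B))) (off_diagonal J)"
proof (rule slice_chartI[where U' = "symmetric_matrices \<inter> {S. invertible (pivot_den J (unshear J S))}"
        and \<psi> = "\<lambda>S. 2 *\<^sub>R pivot J (unshear J S) - mat 1"])
  have t: "transpose J = J" and i: "J ** J = J" using J unfolding proj_onto_def by auto
  have p: "dim W = p" using W unfolding grassmannian_def by simp
  let ?U = "symmetric_matrices \<inter> {B. invertible (pivot_den J (half_sum B))}"
  let ?U' = "symmetric_matrices \<inter> {S. invertible (pivot_den J (unshear J S))}"
  let ?M = "symmetric_orthogonal_matrices p (CARD('n) - p) :: (real^'n^'n) set"
  show "openin (top_of_set symmetric_matrices) ?U" "openin (top_of_set symmetric_matrices) ?U'"
    by (intro openin_open_Int open_invertible_pivot_den smooth_on_half_sum smooth_on_unshear smooth_on_id)+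
  show "(\<lambda>B. shear J (pivot J (half_sum B))) ` ?U \<subseteq> ?U'"
    using invertible_pivot_den_pivot[OF i] transpose_pivot[OF t i] transpose_shear[OF t]
    by (auto simp: symmetric_matrices_def unshear_shear[OF i] transpose_half_sum)
  show "(\<lambda>S. 2 *\<^sub>R pivot J (unshear J S) - mat 1) ` ?U' \<subseteq> ?U"
  proof (rule image_subsetI)
    fix S assume "S \<in> ?U'"
    then have S: "transpose S = S" "invertible (pivot_den J (unshear J S))"
      by (auto simp: symmetric_matrices_def)
    have "transpose (pivot J (unshear J S)) = pivot J (unshear J S)"
      by (rule transpose_pivot[OF t i transpose_unshear[OF t S(1)] S(2)])
    then show "2 *\<^sub>R pivot J (unshear J S) - mat 1 \<in> ?U"
      using invertible_pivot_den_pivot[OF i S(2)]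
        transpose_half_sum[of "2 *\<^sub>R pivot J (unshear J S) - mat 1"]
      by (simp add: symmetric_matrices_def half_sum_inverse(1))
  qed
  show "2 *\<^sub>R pivot J (unshear J (shear J (pivot J (half_sum B)))) - mat 1 = B" if "B \<in> ?U" for B
    using that by (simp add: unshear_shear[OF i] pivot_pivot[OF i] half_sum_inverse)
  show "shear J (pivot J (half_sum (2 *\<^sub>R pivot J (unshear J S) - mat 1))) = S" if "S \<in> ?U'" for S
    using that by (simp add: shear_unshear[OF i] pivot_pivot[OF i] half_sum_inverse)
  show "smooth_on ?U (\<lambda>B. shear J (pivot J (half_sum B)))"
    by (intro smooth_on_shear smooth_on_pivot smooth_on_half_sum smooth_on_id) simp
  show "smooth_on ?U' (\<lambda>S. 2 *\<^sub>R pivot J (unshear J S) - mat 1)"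
    by (intro smooth_on_double smooth_on_pivot smooth_on_unshear smooth_on_id) simp
  show "subspace (off_diagonal J)" "off_diagonal J \<subseteq> symmetric_matrices"
    "dim (off_diagonal J) = dim (hom_complement W)"
    by (rule off_diagonal_subspace[OF J])+
  fix B assume B: "B \<in> ?U"
  show "B \<in> ?M \<longleftrightarrow> shear J (pivot J (half_sum B)) \<in> off_diagonal J"
  proof
    assume "B \<in> ?M"
    then obtain V where V: "V \<in> grassmannian p" "B = reflection V"
      by (rule symmetric_orthogonal_is_reflection)
    then obtain X where X: "X \<in> hom_complement W" "V = graph_over W X"
      using B invertible_pivot_den_imp_graph[OF J p V(1)] by (auto simp: half_sum_reflection)
    have "shear J (pivot J (half_sum B)) = - X - transpose X"
      unfolding V(2) half_sum_reflection X(2) pivot_proj_matrix_graph_over(1)[OF J X(1)]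
      by (rule shear_graph_pivot[OF hom_complementD[OF J X(1)]])
    then show "shear J (pivot J (half_sum B)) \<in> off_diagonal J"
      using hom_complementD(3,4)[OF J X(1)] unfolding off_diagonal_def by blast
  next
    assume "shear J (pivot J (half_sum B)) \<in> off_diagonal J"
    then obtain X where "J ** X = 0" "X ** J = X"
      and S: "shear J (pivot J (half_sum B)) = - X - transpose X"
      unfolding off_diagonal_def by blast
    then have X: "X \<in> hom_complement W" unfolding hom_complement_iff[OF J] by blast
    \<comment> \<open>So far \<open>B\<close> is only a symmetric matrix in the chart domain.
      Undoing the shear and then the pivot reveals \<open>half_sum B\<close> as the projection onto
      the graph of \<open>X\<close>.\<close>
    have "pivot J (half_sum B) = graph_pivot J X"
      using arg_cong[OF S, of "unshear J"] unshear_shear[OF i]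
        shear_graph_pivot[OF hom_complementD[OF J X]] by metis
    then have "half_sum B = pivot J (graph_pivot J X)"
      using pivot_pivot[OF i, of "half_sum B"] B by simp
    then have "B = reflection (graph_over W X)"
      unfolding reflection_graph_over[OF J X] by (metis half_sum_inverse(2))
    then show "B \<in> ?M"
      using reflection_in_symmetric_orthogonal graph_over_in_grassmannian(1)[OF J X p] by simp
  qed
qed

lemma submanifold_symmetric_orthogonal:
  fixes W :: "(real^'n) set"
  assumes W: "W \<in> grassmannian p"
  shows "submanifold (symmetric_matrices :: (real^'n^'n) set) (dim (hom_complement W))
    (symmetric_orthogonal_matrices p (CARD('n) - p))"
  unfolding submanifold_def
proof (intro conjI ballI subspace_symmetric_matrices)
  show "symmetric_orthogonal_matrices p (CARD('n) - p) \<subseteq> (symmetric_matrices :: (real^'n^'n) set)"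
    unfolding symmetric_orthogonal_matrices_def by blast
  fix B :: "real^'n^'n" assume B: "B \<in> symmetric_orthogonal_matrices p (CARD('n) - p)"
  then obtain V where V: "V \<in> grassmannian p" "B = reflection V"
    by (rule symmetric_orthogonal_is_reflection)
  let ?J = "proj_matrix V"
  have J: "proj_onto V ?J"
    using V(1) proj_onto_proj_matrix unfolding grassmannian_def by blast
  \<comment> \<open>With the projection onto its own eigenspace as \<open>?J\<close>, the
    denominator is \<open>mat 1 - ?J + ?J ** ?J\<close>, so every point lies in the chart centred at
    it.\<close>
  then have "pivot_den ?J (half_sum B) = mat 1"
    unfolding V(2) half_sum_reflection pivot_den_def proj_onto_def by simp
  moreover have "invertible (mat 1 :: real^'n^'n)"
    unfolding invertible_det_nz by simp
  ultimately have "B \<in> symmetric_matrices \<inter> {B. invertible (pivot_den ?J (half_sum B))}"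
    using B unfolding symmetric_orthogonal_matrices_def by simp
  then show "\<exists>U \<phi> L. B \<in> U \<and> slice_chart symmetric_matrices (dim (hom_complement W))
      (symmetric_orthogonal_matrices p (CARD('n) - p)) U \<phi> L"
    using slice_chart_symmetric_orthogonal[OF V(1) J, unfolded dim_hom_complement_eq[OF V(1) W]]
    by (intro exI conjI)
qed

section \<open>Real projective space\<close>

text \<open>The linear maps \<open>h\<close> and \<open>k\<close> translate between two coordinate
  systems on one domain. As \<open>k\<close> inverts \<open>h\<close> just on the coordinates that
  occur, the model spaces may lie in different Euclidean spaces.\<close>

lemma compatible_chart_linear:
  assumes c: "compatible_chart M d f c" and dom: "chart_dom c' = chart_dom c"
    and lin: "linear h" "linear k"
    and map: "\<And>x. x \<in> chart_dom c \<Longrightarrow> chart_map c' x = h (chart_map c x)"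
      "\<And>x. x \<in> chart_dom c \<Longrightarrow> k (h (chart_map c x)) = chart_map c x"
    and model: "subspace (chart_model c')" "dim (chart_model c') = d"
      "chart_map c' ` chart_dom c' = chart_model c'"
  shows "compatible_chart M d f c'"
proof -
  obtain \<kappa> where \<kappa>: "smooth_on (f ` chart_dom c) \<kappa>"
    "\<And>x. x \<in> chart_dom c \<Longrightarrow> \<kappa> (f x) = chart_map c x"
    using compatible_chart_kappaE[OF c] by metis
  obtain \<psi> where \<psi>: "smooth_on (chart_map c ` chart_dom c) \<psi>"
    "\<And>x. x \<in> chart_dom c \<Longrightarrow> \<psi> (chart_map c x) = f x"
    using compatible_chart_psiE[OF c] by metis
  have "smooth_on (f ` chart_dom c') (\<lambda>y. h (\<kappa> y))"
    unfolding dom by (rule smooth_on_linear_compose[OF lin(1) \<kappa>(1)])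
  moreover have "smooth_on (chart_map c' ` chart_dom c') (\<lambda>y. \<psi> (k y))"
    unfolding dom by (rule smooth_on_compose[OF smooth_on_linear[OF lin(2)] \<psi>(1)]) (auto simp: map)
  moreover have "openin (top_of_set M) (f ` chart_dom c')"
    using c unfolding compatible_chart_def dom by blast
  moreover have "h (\<kappa> (f x)) = chart_map c' x" "\<psi> (k (chart_map c' x)) = f x"
    if "x \<in> chart_dom c'" for x
    using that unfolding dom by (simp_all add: map \<kappa>(2) \<psi>(2))
  ultimately show ?thesis
    unfolding compatible_chart_def using model by (metis openin_subtopology_self)
qed

lemma projective_space_eq_grassmannian: "projective_space = (grassmannian 1 :: (real^'n) set set)"
proof (intro equalityI subsetI)
  fix V :: "(real^'n) set" assume "V \<in> projective_space"
  then obtain x where "V = span {x}" "x \<noteq> 0" unfolding projective_space_def by blast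
  then show "V \<in> grassmannian 1"
    unfolding grassmannian_def by (simp add: dim_eq_card_independent[of "{x}"])
next
  fix V :: "(real^'n) set" assume "V \<in> grassmannian 1"
  then have V: "subspace V" "dim V = 1" unfolding grassmannian_def by auto
  obtain B where B: "B \<subseteq> V" "independent B" "V \<subseteq> span B" "card B = 1"
    using basis_exists[of V] V(2) by metis
  then obtain x where x: "B = {x}" using card_1_singletonE by metis
  have "V = span {x}" using B(1,3) V(1) span_minimal unfolding x by blast
  moreover have "x \<noteq> 0" using B(2) unfolding x by (metis dependent_zero insertI1)
  ultimately show "V \<in> projective_space" unfolding projective_space_def by blast
qed

context
  fixes i :: "'n::finite"
begin

abbreviation (input) coordinate_axis :: "(real^'n) set" where
  "coordinate_axis \<equiv> span {axis i 1}"

lemma coordinate_axis_in_grassmannian: "coordinate_axis \<in> grassmannian 1"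
  unfolding projective_space_eq_grassmannian[symmetric] projective_space_def
  by (auto simp: axis_eq_0_iff)

lemma orthogonal_comp_coordinate_axis: "orthogonal_comp coordinate_axis = {y :: real^'n. y $ i = 0}"
  unfolding orthogonal_comp_def orthogonal_def span_singleton
  by (auto simp: inner_axis' )

text \<open>The vector \<open>x - (x $ i) *\<^sub>R axis i 1\<close> is orthogonal to the axis and
  so killed by \<open>X\<close>; hence \<open>X\<close> is determined by its value at
  \<open>axis i 1\<close>.\<close>

lemma hom_coordinate_axis:
  assumes "X \<in> hom_complement coordinate_axis"
  shows "X *v x = (x $ i) *\<^sub>R (X *v axis i 1)" "(X *v axis i 1) $ i = 0"
proof -
  have "x - (x $ i) *\<^sub>R axis i 1 \<in> orthogonal_comp coordinate_axis"
    unfolding orthogonal_comp_coordinate_axis by simp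
  then have "X *v (x - (x $ i) *\<^sub>R axis i 1) = 0"
    using assms unfolding hom_complement_def by blast
  then show "X *v x = (x $ i) *\<^sub>R (X *v axis i 1)"
    by (simp add: matrix_vector_mult_diff_distrib matrix_vector_mult_scaleR)
  have "X *v axis i 1 \<in> orthogonal_comp coordinate_axis"
    using assms unfolding hom_complement_def by (simp add: span_base)
  then show "(X *v axis i 1) $ i = 0"
    unfolding orthogonal_comp_coordinate_axis by simp
qed

lemma graph_over_coordinate_axis:
  "graph_over coordinate_axis X = span {axis i 1 + X *v axis i 1}"
proof -
  have "graph_over coordinate_axis X = (\<lambda>x. x + X *v x) ` coordinate_axis"
    unfolding graph_over_def by auto
  then show ?thesis
    by (simp add: span_singleton image_image matrix_vector_mult_scaleR scaleR_add_right)
qed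

text \<open>With \<open>y = X *v axis i 1\<close>, the line is spanned by
  \<open>axis i 1 + y\<close>, where \<open>y $ i = 0\<close>, and quotients of homogeneous
  coordinates are unaffected by rescaling.\<close>

lemma chart_map_projective_graph_over:
  assumes X: "X \<in> hom_complement coordinate_axis"
  shows "chart_map (projective_chart i) (graph_over coordinate_axis X) = X *v axis i 1"
proof -
  let ?y = "X *v axis i 1"
  have y: "?y $ i = 0" by (rule hom_coordinate_axis(2)[OF X])
  have eq: "(\<chi> j. if j = i then 0 else (c *\<^sub>R (axis i 1 + ?y)) $ j / (c *\<^sub>R (axis i 1 + ?y)) $ i) = ?y"
    if "c \<noteq> 0" for c
    using that y by (auto simp: vec_eq_iff axis_def)
  show ?thesis
    unfolding projective_chart_def chart.sel graph_over_coordinate_axis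
  proof (rule the_equality)
    show "\<exists>x\<in>span {axis i 1 + ?y}. x $ i \<noteq> 0 \<and> ?y = (\<chi> j. if j = i then 0 else x $ j / x $ i)"
      by (rule bexI[of _ "1 *\<^sub>R (axis i 1 + ?y)"], rule conjI[OF _ eq[symmetric]])
         (simp_all add: y span_base)
    fix z assume "\<exists>x\<in>span {axis i 1 + ?y}. x $ i \<noteq> 0 \<and> z = (\<chi> j. if j = i then 0 else x $ j / x $ i)"
    then obtain c where c: "(c *\<^sub>R (axis i 1 + ?y)) $ i \<noteq> 0"
      "z = (\<chi> j. if j = i then 0 else (c *\<^sub>R (axis i 1 + ?y)) $ j / (c *\<^sub>R (axis i 1 + ?y)) $ i)"
      unfolding span_singleton by blast
    have "c \<noteq> 0" using c(1) by auto
    then show "z = ?y" using eq c(2) by simp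
  qed
qed

text \<open>The outer product of \<open>y\<close> with the \<open>i\<close>-th unit vector; for
  \<open>y $ i = 0\<close> it inverts evaluation at \<open>axis i 1\<close>.\<close>

definition axis_hom :: "real^'n \<Rightarrow> real^'n^'n" where
  "axis_hom y = (\<chi> a b. if b = i then y $ a else 0)"

lemma axis_hom_apply: "axis_hom y *v x = (x $ i) *\<^sub>R y"
  unfolding axis_hom_def
  by (simp add: vec_eq_iff matrix_vector_mult_def if_distrib[of "\<lambda>u. u * _"] mult.commute[of "x $ i"]
      cong: if_cong)

lemma axis_hom_in_hom_complement: "y $ i = 0 \<Longrightarrow> axis_hom y \<in> hom_complement coordinate_axis"
  unfolding hom_complement_def orthogonal_comp_coordinate_axis by (simp add: axis_hom_apply)

lemma axis_hom_inverse:
  assumes "X \<in> hom_complement coordinate_axis"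
  shows "axis_hom (X *v axis i 1) = X"
  unfolding matrix_eq axis_hom_apply by (intro allI hom_coordinate_axis(1)[OF assms, symmetric])

lemma chart_dom_projective_chart:
  "chart_dom (projective_chart i) = chart_dom (grassmannian_chart 1 coordinate_axis)"
proof -
  have "span {x} \<inter> {y. y $ i = 0} = {0} \<longleftrightarrow> x $ i \<noteq> 0" if "x \<noteq> 0" for x :: "real^'n"
  proof
    assume "span {x} \<inter> {y. y $ i = 0} = {0}"
    then show "x $ i \<noteq> 0" using that span_base[of x "{x}"] by blast
  next
    assume "x $ i \<noteq> 0"
    then show "span {x} \<inter> {y. y $ i = 0} = {0}" unfolding span_singleton by auto
  qed
  moreover have "x \<noteq> 0" if "x $ i \<noteq> 0" for x :: "real^'n" using that by auto
  ultimately show ?thesis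
    unfolding projective_chart_def grassmannian_chart_def chart.sel orthogonal_comp_coordinate_axis
      projective_space_eq_grassmannian[symmetric] projective_space_def
    by blast
qed

lemma compatible_projective_chart:
  "compatible_chart (symmetric_orthogonal_matrices 1 (CARD('n) - 1)) (dim (hom_complement coordinate_axis))
    reflection (projective_chart i)"
proof (rule compatible_chart_linear[OF compatible_grassmannian_chart[OF coordinate_axis_in_grassmannian]
        chart_dom_projective_chart, where h = "\<lambda>X. X *v axis i 1" and k = axis_hom])
  obtain J where J: "proj_onto coordinate_axis J"
    using proj_onto_exists[OF subspace_span] by blast
  have d: "dim coordinate_axis = 1"
    using coordinate_axis_in_grassmannian unfolding grassmannian_def by blast
  note dom = chart_dom_grassmannian_chart[OF J d]
  show lin: "linear (\<lambda>X :: real^'n^'n. X *v axis i 1)"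
    by (rule linearI) (simp_all add: matrix_vector_mult_add_rdistrib scaleR_matrix_vector_assoc)
  show "linear axis_hom"
    by (rule linearI) (auto simp: axis_hom_def vec_eq_iff)
  show "chart_map (projective_chart i) V = chart_map (grassmannian_chart 1 coordinate_axis) V *v axis i 1"
    "axis_hom (chart_map (grassmannian_chart 1 coordinate_axis) V *v axis i 1) =
      chart_map (grassmannian_chart 1 coordinate_axis) V"
    if "V \<in> chart_dom (grassmannian_chart 1 coordinate_axis)" for V
    using that unfolding dom
    by (auto simp: chart_map_projective_graph_over chart_map_graph_over[OF J] axis_hom_inverse)
  \<comment> \<open>Presenting the hyperplane as an injective linear image of the Grassmannian model
    space settles its dimension and the surjectivity of the chart.\<close>
  have model: "chart_model (projective_chart i) = (\<lambda>X. X *v axis i 1) ` hom_complement coordinate_axis"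
  proof -
    have "y \<in> (\<lambda>X. X *v axis i 1) ` hom_complement coordinate_axis" if "y $ i = 0" for y
      using axis_hom_in_hom_complement[OF that]
      by (intro image_eqI[of _ _ "axis_hom y"]) (simp_all add: axis_hom_apply)
    then show ?thesis
      unfolding projective_chart_def chart.sel using hom_coordinate_axis(2) by blast
  qed
  show "subspace (chart_model (projective_chart i))"
    unfolding model by (rule linear_subspace_image[OF lin subspace_hom_complement[OF J]])
  have "inj_on (\<lambda>X. X *v axis i 1) (hom_complement coordinate_axis)"
    by (rule inj_on_inverseI[where g = axis_hom]) (rule axis_hom_inverse)
  then show "dim (chart_model (projective_chart i)) = dim (hom_complement coordinate_axis)"
    unfolding model by (rule dim_image_subspace[OF lin subspace_hom_complement[OF J]])
  show "chart_map (projective_chart i) ` chart_dom (projective_chart i) = chart_model (projective_chart i)"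
    unfolding model chart_dom_projective_chart dom
    by (auto simp: chart_map_projective_graph_over image_image)
qed

end

lemma compatible_projective_atlas:
  fixes W :: "(real^'n) set"
  assumes "W \<in> grassmannian 1"
  shows "compatible_atlas (symmetric_orthogonal_matrices 1 (CARD('n) - 1)) (dim (hom_complement W))
    reflection (projective_atlas :: ((real^'n) set, real^'n) chart set)"
  unfolding compatible_atlas_def atlas_carrier_projective projective_space_eq_grassmannian
proof (intro conjI ballI)
  fix c :: "((real^'n) set, real^'n) chart" assume "c \<in> projective_atlas"
  then obtain i where "c = projective_chart i" unfolding projective_atlas_def by blast
  then show "compatible_chart (symmetric_orthogonal_matrices 1 (CARD('n) - 1)) (dim (hom_complement W))
      reflection c"
    using compatible_projective_chart[of i]
      dim_hom_complement_eq[OF assms coordinate_axis_in_grassmannian[of i]] by simp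
qed (rule bij_betw_reflection)

lemma grassmannian_nonempty:
  assumes "p \<le> CARD('n)"
  obtains W :: "(real^'n) set" where "W \<in> grassmannian p"
  using choose_subspace_of_subspace[of p "UNIV :: (real^'n) set"] assms
  unfolding grassmannian_def by auto

theorem proposition4p14:
  fixes p :: nat
  assumes "p \<le> CARD('n::finite)"
  shows "(\<exists>d. submanifold (symmetric_matrices :: (real^'n^'n) set) d
            (symmetric_orthogonal_matrices p (CARD('n) - p)) \<and>
          diffeomorphic
            (submanifold_atlas (symmetric_matrices :: (real^'n^'n) set) d
              (symmetric_orthogonal_matrices p (CARD('n) - p)))
            (grassmannian_atlas p :: ((real^'n) set, real^'n^'n) chart set)) \<and>
         (\<exists>d. submanifold (symmetric_matrices :: (real^'n^'n) set) d
            (symmetric_orthogonal_matrices 1 (CARD('n) - 1)) \<and>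
          diffeomorphic
            (submanifold_atlas (symmetric_matrices :: (real^'n^'n) set) d
              (symmetric_orthogonal_matrices 1 (CARD('n) - 1)))
            (projective_atlas :: ((real^'n) set, real^'n) chart set))"
proof (intro conjI)
  \<comment> \<open>The bound on \<open>p\<close> supplies a subspace \<open>W\<close>, which serves
    to name the dimension.\<close>
  obtain W :: "(real^'n) set" where W: "W \<in> grassmannian p"
    using grassmannian_nonempty[OF assms] .
  note sub = submanifold_symmetric_orthogonal[OF W]
  show "\<exists>d. submanifold (symmetric_matrices :: (real^'n^'n) set) d
            (symmetric_orthogonal_matrices p (CARD('n) - p)) \<and>
          diffeomorphic
            (submanifold_atlas (symmetric_matrices :: (real^'n^'n) set) d
              (symmetric_orthogonal_matrices p (CARD('n) - p)))
            (grassmannian_atlas p :: ((real^'n) set, real^'n^'n) chart set)"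
    using sub diffeomorphic_compatible_atlas[OF compatible_submanifold_atlas[OF sub]
        compatible_grassmannian_atlas[OF W]] by blast
next
  \<comment> \<open>Index types are nonempty, so a line exists whatever \<open>p\<close> is.\<close>
  have "1 \<le> CARD('n)" by (simp add: Suc_le_eq)
  then obtain W :: "(real^'n) set" where W: "W \<in> grassmannian 1"
    using grassmannian_nonempty by blast
  note sub = submanifold_symmetric_orthogonal[OF W]
  show "\<exists>d. submanifold (symmetric_matrices :: (real^'n^'n) set) d
            (symmetric_orthogonal_matrices 1 (CARD('n) - 1)) \<and>
          diffeomorphic
            (submanifold_atlas (symmetric_matrices :: (real^'n^'n) set) d
              (symmetric_orthogonal_matrices 1 (CARD('n) - 1)))
            (projective_atlas :: ((real^'n) set, real^'n) chart set)"
    using sub diffeomorphic_compatible_atlas[OF compatible_submanifold_atlas[OF sub]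
        compatible_projective_atlas[OF W]] by blast
qed

end
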